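(* There is an absolute constant $c_2>0$ such that the following holds. Let $Q,N\ge 1$ be real numbers, let $(a_n)$ be any sequence of complex numbers, and put $S(\alpha):=\sum_{n\le N}a_ne(n\alpha)$ and $Z:=\sum_{n\le N}|a_n|^2$. Let $0\le M\le Q$ and let $\mathcal{S}\subset(M,M+Q]$ be a set of natural numbers. For $t\in\mathbb{N}$ let $\mathcal{S}_t:=\{q\in\mathbb{N}: tq\in\mathcal{S}\}$ and $S_t:=|\mathcal{S}_t|$, and for $u>0$, $t,k\in\mathbb{N}$, $l\in\mathbb{Z}$ define $$A_t(u,k,l):=\max_{M/t\le y\le (M+Q)/t}\bigl|\{q\in\mathcal{S}_t\cap(y,y+u]:\ q\equiv l\bmod k\}\bigr|.$$ Put $U:=1$ if $M<\sqrt N$ and $U:=0$ otherwise. Let $C,X$ be real numbers and let $\delta_t(k,l)\ge 0$ be real numbers (depending on $t$, $k$ and the residue class of $l$ modulo $k$) such that, for all $t\in\mathbb{N}$ with $t\le\sqrt N$, all $k\in\mathbb{N}$ with $k\le\sqrt N/t$, all $l\in\mathbb{Z}$ with $(k,l)=1$, and all $u$ with $kQ/\sqrt N\le u\le Q/t$, the following three conditions hold: (i) $A_t(u,k,l)\le C\left(1+\dfrac{S_t/k}{Q/t}\cdot u\right)\delta_t(k,l)$; (ii) $\displaystyle\sum_{\substack{l'=1\\(k,l')=1}}^{k}\delta_t(k,l')\le k$; (iii) $\delta_t(k,l)\le X$. Then $$\sum_{q\in\mathcal{S}}\ \sum_{\substack{a=1\\(a,q)=1}}^{q}\left|S\!\left(\frac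 aq\right)\right|^2\le c_2C\left(NU+\bigl(\min\{QX,N\}+Q\bigr)\Bigl(\sqrt N\log\log 10N+\max_{r\le\sqrt N}\sum_{t\mid r}S_t\Bigr)\right)Z,$$ where $r$ ranges over natural numbers.
   Context: $e(x)=e^{2\pi i x}$. Sums over $n\le N$ are over positive integers.
   Formalization: The formal theorem additionally assumes C ≥ 0; for C < 0 condition (i) forces the set of moduli to be empty and the claimed bound fails whenever Z > 0 (e.g. empty set, all δ = 0, X = 0, C = −1). *)

theory Defs
  imports Complex_Main "HOL-Number_Theory.Cong"
begin

definition e :: "real \<Rightarrow> complex" where
  "e x = exp (2 * of_real pi * \<i> * of_real x)"

definition pos_upto :: "real \<Rightarrow> nat set" where
  "pos_upto x = {n. 1 \<le> n \<and> real n \<le> x}"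

definition exp_sum :: "(nat \<Rightarrow> complex) \<Rightarrow> real \<Rightarrow> real \<Rightarrow> complex" where
  "exp_sum a N \<alpha> = (\<Sum>n\<in>pos_upto N. a n * e (real n * \<alpha>))"

definition quot_set :: "nat set \<Rightarrow> nat \<Rightarrow> nat set" where
  "quot_set S t = {q. 1 \<le> q \<and> t * q \<in> S}"

text \<open>
  \<open>max_count M Q S t u k l\<close> is $A_t(u,k,l)$. Here \<open>y\<close> ranges over real numbers; for finite
  \<open>S\<close> and \<open>t \<ge> 1\<close> the counts take finitely many values, so \<open>Max\<close> is attained.
\<close>

definition max_count :: "real \<Rightarrow> real \<Rightarrow> nat set \<Rightarrow> nat \<Rightarrow> real \<Rightarrow> nat \<Rightarrow> int \<Rightarrow> nat" where
  "max_count M Q S t u k l =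
     Max ((\<lambda>y::real. card {q \<in> quot_set S t.
                           y < real q \<and> real q \<le> y + u \<and> [int q = l] (mod int k)})
          ` {M / real t .. (M + Q) / real t})"

end

theory Submission
  imports Defs "HOL-Analysis.Analysis" "HOL-Number_Theory.Prime_Powers"
begin

text \<open>
  By the large sieve for points of bounded density, it suffices to bound the number of reduced
  fractions $a/q$, $q \in S$, in an interval of length about $1/N$ starting at a given $\alpha$.
  Dirichlet's theorem gives $\alpha = b/r + z$ with $r \le \sqrt N$ and $z \ll 1/(r \sqrt N)$. The
  integer $m = ar - bq$ vanishes only if $q = r$, which requires $M < \sqrt N$ and accounts for the
  term $NU$. Otherwise $m \ll Q r \zeta$, where $\zeta$ is $|z|$ truncated to
  $[1/N, 1/(r \sqrt N)]$, and $m$ confines $q$ to an interval of length $\ll Q/(N\zeta)$; with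
  $t = (q, r) = (m, r)$ it also fixes the residue class of $q/t$ modulo $k = r/t$. Hypothesis (i) thus
  bounds the number of $q$ belonging to a given $m$. In the sum over $m$, hypothesis (ii) applies to
  each full period modulo $k$, while for an incomplete period there is also the bound (iii).
  Finally $\sum_{t \mid r} r/t = \sigma(r) \ll r \log\log 10N$.
\<close>

section \<open>Sums over divisors\<close>

text \<open>The obstacle is the restricted range of u in (i). With u = Q / (N \<zeta>) / t and k = r
  / t, the condition u \<le> Q / t says exactly \<zeta> \<ge> 1/N, and k Q / sqrt N \<le> u says
  exactly \<zeta> \<le> 1 / (r sqrt N); hence the truncation of |z| at both ends. The balance for
  one t: about Q k \<zeta> offsets occur, and on average over the residues (i) allows about C (1 +
  S_t / (k N \<zeta>)) moduli for each. The product is C Q \<zeta> (k + S_t / (N \<zeta>)). After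
  multiplication by N the second part is C Q S_t, free of \<zeta>, and the first is at most C Q sqrt
  N / t by the upper truncation. If the offsets do not fill one period modulo k, the factor Q
  \<zeta> gives way to min 1 (X Q \<zeta>), and this is the origin of min {QX, N}. The constant is
  307200 = 128 * 20 * 120: the loss in the large sieve, the divisor sum, and the count of
  fractions.\<close>

lemma harm_le_ln_plus_1:
  assumes "n > 0"
  shows "(harm n :: real) \<le> ln (real n) + 1"
  using euler_mascheroni_sequence_decreasing[of 1 n] assms by (simp add: harm_def)

text \<open>A weak form of Mertens' first theorem: log n! is the sum of Lambda(g) floor(n/g) and is
  at most n log n, while floor(n/g) > n / (2 g) for g \<le> n.\<close>

lemma sum_mangoldt_over_id_le:
  assumes "n > 0"
  shows "(\<Sum>g=1..n. mangoldt g / real g) \<le> 2 * ln (real n)"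
proof -
  have "real n / 2 * (\<Sum>g=1..n. mangoldt g / real g) \<le> (\<Sum>g=1..n. mangoldt g * real (n div g))"
    unfolding sum_distrib_left
  proof (rule sum_mono)
    fix g assume g: "g \<in> {1..n}"
    have "n < g * (n div g) + g"
      using g by (metis atLeastAtMost_iff dividend_less_div_times mult.commute less_eq_Suc_le One_nat_def add.commute)
    also have "\<dots> \<le> g * (2 * (n div g))"
    proof -
      have "n div g \<ge> 1" using g by (simp add: div_greater_zero_iff Suc_le_eq)
      then have "g * 1 \<le> g * (n div g)" by (intro mult_left_mono) auto
      then show ?thesis by simp
    qed
    finally have "real n < real g * (2 * real (n div g))"
      by (metis of_nat_less_iff of_nat_mult of_nat_numeral)
    then have "real n / 2 / real g \<le> real (n div g)"
      using g by (simp add: field_simps)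
    then have "mangoldt g * (real n / 2 / real g) \<le> mangoldt g * real (n div g)"
      by (intro mult_left_mono mangoldt_nonneg)
    then show "real n / 2 * (mangoldt g / real g) \<le> mangoldt g * real (n div g)"
      by (simp add: field_simps)
  qed
  also have "\<dots> = (\<Sum>g=1..n. \<Sum>m | m \<in> {1..n} \<and> g dvd m. mangoldt g)"
  proof (rule sum.cong[OF refl])
    fix g assume g: "g \<in> {1..n}"
    have "{m. m \<in> {1..n} \<and> g dvd m} = (\<lambda>j. g * j) ` {1..n div g}"
    proof safe
      fix m assume m: "m \<in> {1..n}" "g dvd m"
      then obtain j where j: "m = g * j" by auto
      have "j \<in> {1..n div g}" using m j g
        by (auto simp: less_eq_div_iff_mult_less_eq mult.commute Suc_le_eq)
      then show "m \<in> (\<lambda>j. g * j) ` {1..n div g}" using j by auto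
    qed (use g in \<open>auto simp: less_eq_div_iff_mult_less_eq mult.commute Suc_le_eq\<close>)
    moreover have "inj_on (\<lambda>j. g * j) {1..n div g}" using g by (auto intro!: inj_onI)
    ultimately have "card {m. m \<in> {1..n} \<and> g dvd m} = n div g"
      by (simp add: card_image)
    then show "mangoldt g * real (n div g) = (\<Sum>m | m \<in> {1..n} \<and> g dvd m. mangoldt g)"
      by simp
  qed
  also have "\<dots> = (\<Sum>m=1..n. \<Sum>g | g \<in> {1..n} \<and> g dvd m. mangoldt g)"
    by (rule sum.swap_restrict) auto
  also have "\<dots> = (\<Sum>m=1..n. ln (real m))"
  proof (rule sum.cong[OF refl])
    fix m assume m: "m \<in> {1..n}"
    then have "{g. g \<in> {1..n} \<and> g dvd m} = {g. g dvd m}"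
      by (auto dest: dvd_imp_le intro: Nat.gr0I simp: Suc_le_eq)
    then show "(\<Sum>g | g \<in> {1..n} \<and> g dvd m. mangoldt g) = ln (real m)"
      using mangoldt_sum[of m, where 'a = real] m by simp
  qed
  also have "\<dots> \<le> (\<Sum>m=1..n. ln (real n))"
    by (intro sum_mono) auto
  also have "\<dots> = real n * ln (real n)" by simp
  finally show ?thesis using assms by (simp add: field_simps)
qed

text \<open>The divisors are split at y. Those up to y fall under the full sum over g \<le> y; the
  others have 1/g \<le> 1/y, and the weights Lambda(g) over all divisors add up to log r \<le> y.
  Since any such y is allowed, log (10 N) can serve all r at once.\<close>

lemma sum_divisors_mangoldt_over_id_le:
  assumes r: "r > 0" and y: "y \<ge> 1" "ln (real r) \<le> y"
  shows "(\<Sum>g | g dvd r. mangoldt g / real g) \<le> 2 * ln y + 1"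
proof -
  define n where "n = nat \<lfloor>y\<rfloor>"
  have n: "n > 0" "real n \<le> y" "y < real n + 1" using y unfolding n_def by linarith+
  have fin: "finite {g. g dvd r}" using r by simp
  have "(\<Sum>g | g dvd r. mangoldt g / real g) \<le>
        (\<Sum>g | g dvd r. (if g \<le> n then mangoldt g / real g else 0) + mangoldt g / y)"
  proof (rule sum_mono)
    fix g assume g: "g \<in> {g. g dvd r}"
    have "g > 0" using g r by (auto intro: Nat.gr0I)
    show "mangoldt g / real g \<le> (if g \<le> n then mangoldt g / real g else 0) + mangoldt g / y"
    proof (cases "g \<le> n")
      case False
      then have "y \<le> real g" using n by linarith
      then show ?thesis using False y \<open>g > 0\<close>
        by (auto intro!: divide_left_mono mangoldt_nonneg)
    qed (use y mangoldt_nonneg[of g] in simp)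
  qed
  also have "\<dots> = (\<Sum>g | g dvd r \<and> g \<le> n. mangoldt g / real g) + (\<Sum>g | g dvd r. mangoldt g) / y"
    using sum.inter_filter[OF fin, of "\<lambda>g. mangoldt g / real g" "\<lambda>g. g \<le> n"]
    by (simp add: sum.distrib sum_divide_distrib)
  also have "(\<Sum>g | g dvd r \<and> g \<le> n. mangoldt g / real g) \<le> (\<Sum>g=1..n. mangoldt g / real g)"
    using r by (intro sum_mono2) (auto intro!: divide_nonneg_nonneg mangoldt_nonneg Nat.gr0I simp: Suc_le_eq)
  also have "\<dots> \<le> 2 * ln (real n)" by (rule sum_mangoldt_over_id_le) fact
  also have "\<dots> \<le> 2 * ln y" using n by simp
  also have "(\<Sum>g | g dvd r. mangoldt g) / y \<le> 1"
    using mangoldt_sum[of r, where 'a = real] r y by simp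
  finally show ?thesis by simp
qed

text \<open>Write log d as the sum of Lambda(g) over g | d and put d = g j: the cofactor j again
  divides r, so the inner sum is at most 1/g times the full sum of 1/d.\<close>

lemma sum_divisors_ln_over_id_le:
  assumes r: "r > 0"
  shows "(\<Sum>d | d dvd r. ln (real d) / real d)
           \<le> (\<Sum>g | g dvd r. mangoldt g / real g) * (\<Sum>d | d dvd r. 1 / real d)"
proof -
  have fin: "finite {g. g dvd r}" using r by simp
  have "(\<Sum>d | d dvd r. ln (real d) / real d)
      = (\<Sum>d | d dvd r. \<Sum>g | g \<in> {g. g dvd r} \<and> g dvd d. mangoldt g / real d)"
  proof (rule sum.cong[OF refl])
    fix d assume d: "d \<in> {d. d dvd r}"
    then have "d \<noteq> 0" using r by auto
    have eq: "{g. g \<in> {g. g dvd r} \<and> g dvd d} = {g. g dvd d}" using d by (auto intro: dvd_trans)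
    show "ln (real d) / real d = (\<Sum>g | g \<in> {g. g dvd r} \<and> g dvd d. mangoldt g / real d)"
      unfolding eq using mangoldt_sum[OF \<open>d \<noteq> 0\<close>, where 'a = real]
      by (simp flip: sum_divide_distrib)
  qed
  also have "\<dots> = (\<Sum>g | g dvd r. \<Sum>d | d \<in> {d. d dvd r} \<and> g dvd d. mangoldt g / real d)"
    by (rule sum.swap_restrict) (use fin in auto)
  also have "\<dots> \<le> (\<Sum>g | g dvd r. mangoldt g / real g * (\<Sum>d | d dvd r. 1 / real d))"
  proof (rule sum_mono)
    fix g assume g: "g \<in> {g. g dvd r}"
    then have "g > 0" using r by (auto intro: Nat.gr0I)
    have "(\<Sum>d | d \<in> {d. d dvd r} \<and> g dvd d. 1 / real d)
          = (\<Sum>d \<in> (\<lambda>j. g * j) ` {j. g * j dvd r}. 1 / real d)"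
      by (intro sum.cong) (auto elim!: dvdE)
    also have "\<dots> = (\<Sum>j | g * j dvd r. 1 / real (g * j))"
      using \<open>g > 0\<close> by (subst sum.reindex) (auto intro!: inj_onI)
    also have "\<dots> = (\<Sum>j | g * j dvd r. 1 / real j) / real g"
      by (simp add: sum_divide_distrib mult.commute)
    also have "\<dots> \<le> (\<Sum>j | j dvd r. 1 / real j) / real g"
      by (intro divide_right_mono sum_mono2 fin) (auto intro: dvd_mult_right)
    finally have "mangoldt g * (\<Sum>d | d \<in> {d. d dvd r} \<and> g dvd d. 1 / real d)
                 \<le> mangoldt g * ((\<Sum>j | j dvd r. 1 / real j) / real g)"
      by (intro mult_left_mono mangoldt_nonneg)
    then show "(\<Sum>d | d \<in> {d. d dvd r} \<and> g dvd d. mangoldt g / real d)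
               \<le> mangoldt g / real g * (\<Sum>d | d dvd r. 1 / real d)"
      by (simp add: sum_distrib_left sum_divide_distrib mult.commute)
  qed
  finally show ?thesis by (simp add: sum_distrib_right)
qed

text \<open>
  Rankin's trick: the average of $\log d$ over the divisors $d$ of $r$ with weights $1/d$ is at most
  $L = 2 \log y + 1$, so the divisors $d \le e^{2L}$ carry at least half of the total weight.
\<close>

lemma sum_divisors_inverse_le:
  assumes r: "r > 0" and y: "y \<ge> 1" "ln (real r) \<le> y"
  shows "(\<Sum>d | d dvd r. 1 / real d) \<le> 8 * ln y + 6"
proof -
  define L where "L = 2 * ln y + 1"
  define f where "f = (\<Sum>d | d dvd r. 1 / real d)"
  define n where "n = nat \<lfloor>exp (2 * L)\<rfloor>"
  have L: "L \<ge> 1" using y by (simp add: L_def)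
  then have n: "n > 0" "real n \<le> exp (2 * L)" "exp (2 * L) < real n + 1"
    using one_le_exp_iff[of "2 * L"] unfolding n_def by linarith+
  have fin: "finite {g. g dvd r}" using r by simp
  have f0: "f \<ge> 0" by (simp add: f_def sum_nonneg)
  have "f \<le> (\<Sum>d | d dvd r. (if d \<le> n then 1 / real d else 0) + ln (real d) / real d / (2 * L))"
    unfolding f_def
  proof (rule sum_mono)
    fix d assume d: "d \<in> {d. d dvd r}"
    then have "d > 0" using r by (auto intro: Nat.gr0I)
    then have "ln (real d) \<ge> 0" by simp
    show "1 / real d \<le> (if d \<le> n then 1 / real d else 0) + ln (real d) / real d / (2 * L)"
    proof (cases "d \<le> n")
      case False
      then have "exp (2 * L) \<le> real d" using n by linarith
      then have "2 * L \<le> ln (real d)" using \<open>d > 0\<close> by (simp add: ln_ge_iff)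
      then show ?thesis using False L \<open>d > 0\<close> by (simp add: field_simps)
    qed (use L \<open>ln (real d) \<ge> 0\<close> in simp)
  qed
  also have "\<dots> = (\<Sum>d | d dvd r \<and> d \<le> n. 1 / real d)
                  + (\<Sum>d | d dvd r. ln (real d) / real d) / (2 * L)"
    using sum.inter_filter[OF fin, of "\<lambda>d. 1 / real d" "\<lambda>d. d \<le> n"]
    by (simp add: sum.distrib sum_divide_distrib)
  also have "(\<Sum>d | d dvd r \<and> d \<le> n. 1 / real d) \<le> (\<Sum>d=1..n. 1 / real d)"
    using r by (intro sum_mono2) (auto intro!: Nat.gr0I simp: Suc_le_eq)
  also have "\<dots> = harm n" by (simp add: harm_def field_simps)
  also have "\<dots> \<le> ln (real n) + 1" by (rule harm_le_ln_plus_1) fact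
  also have "ln (real n) \<le> 2 * L" using n by (metis ln_exp ln_le_cancel_iff exp_gt_zero of_nat_0_less_iff)
  also have "(\<Sum>d | d dvd r. ln (real d) / real d) \<le> L * f"
    using sum_divisors_ln_over_id_le[OF r]
      mult_right_mono[OF sum_divisors_mangoldt_over_id_le[OF r y] f0]
    unfolding f_def L_def by linarith
  \<comment> \<open>The last term is f/2; moving it to the left doubles the rest.\<close>
  finally have "f \<le> 2 * L + 1 + L * f / (2 * L)" using L by (simp add: divide_right_mono)
  then have "f \<le> 2 * (2 * L + 1)" using L by simp
  then show ?thesis unfolding f_def L_def by simp
qed

text \<open>The factor 10 keeps log log 10N away from 0, because e^2 \<le> 9 < 10 N. Additive
  constants can then be absorbed, as in 8 x + 6 \<le> 20 x for x \<ge> 1/2.\<close>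

lemma half_le_ln_ln:
  fixes N :: real
  assumes "N \<ge> 1"
  shows "ln (10 * N) \<ge> 2" "ln (ln (10 * N)) \<ge> 1 / 2"
proof -
  have "exp (1 / 2) ^ 2 = exp (1 :: real)" by (simp flip: exp_of_nat_mult)
  then have "exp (1 / 2) ^ 2 \<le> (2 :: real) ^ 2" using exp_le by simp
  then have e1: "exp (1 / 2) \<le> (2 :: real)" by (rule power2_le_imp_le) simp
  have "exp 2 = exp (1 :: real) ^ 2" by (simp flip: exp_of_nat_mult)
  also have "\<dots> \<le> 3 ^ 2" by (intro power_mono exp_le) auto
  finally have "exp 2 \<le> 10 * N" using assms by simp
  then show 2: "ln (10 * N) \<ge> 2" using assms by (simp add: ln_ge_iff)
  then show "ln (ln (10 * N)) \<ge> 1 / 2" using e1 by (subst ln_ge_iff) auto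
qed

lemma sum_divisors_inverse_le_ln_ln:
  assumes N: "N \<ge> 1" and r: "r > 0" "real r \<le> sqrt N"
  shows "(\<Sum>d | d dvd r. 1 / real d) \<le> 20 * ln (ln (10 * N))"
proof -
  have "sqrt N \<le> N" using N real_sqrt_le_mono[of N "N^2"] by (simp add: power2_eq_square)
  then have "real r \<le> 10 * N" using r N by linarith
  then have "ln (real r) \<le> ln (10 * N)" using r N by simp
  then show ?thesis
    using sum_divisors_inverse_le[of r "ln (10 * N)"] half_le_ln_ln[OF N] r by linarith
qed

section \<open>The large sieve for points of bounded density\<close>

lemma e_add: "e (x + y) = e x * e y"
  by (simp add: e_def exp_add[symmetric] algebra_simps)

lemma norm_e [simp]: "cmod (e x) = 1"
  by (simp add: e_def)

lemma cnj_e: "cnj (e x) = e (- x)"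
  by (simp add: e_def exp_cnj)

lemma norm_e_minus_1: "cmod (e x - 1) = 2 * \<bar>sin (pi * x)\<bar>"
  using dist_exp_i_1[of "2 * pi * x"] by (simp add: e_def mult_ac)

text \<open>Jordan's inequality: on [0, pi/2] the concave sine lies above its chord.\<close>

lemma two_x_le_sin_pi_x:
  assumes "0 \<le> x" "x \<le> 1 / 2"
  shows "2 * x \<le> sin (pi * x)"
proof -
  have "concave_on {0..pi/2} (sin :: real \<Rightarrow> real)"
    by (rule f''_le0_imp_concave[where f' = cos and f'' = "\<lambda>x. - sin x"])
       (auto intro!: derivative_eq_intros sin_ge_zero)
  from concave_onD[OF this, of "2 * x" 0 "pi / 2"] show ?thesis
    using assms by (simp add: mult_ac)
qed

section \<open>Dirichlet sums at points of bounded density\<close>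

definition dirichlet_sum :: "nat \<Rightarrow> real \<Rightarrow> complex" where
  "dirichlet_sum L x = (\<Sum>j<L. e (real j * x))"

lemma norm_dirichlet_sum_le: "cmod (dirichlet_sum L x) \<le> real L"
  unfolding dirichlet_sum_def by (rule order_trans[OF norm_sum]) simp

lemma cnj_dirichlet_sum: "cnj (dirichlet_sum L x) = dirichlet_sum L (- x)"
  by (simp add: dirichlet_sum_def cnj_e)

lemma norm_dirichlet_sum_uminus: "cmod (dirichlet_sum L (- x)) = cmod (dirichlet_sum L x)"
  by (metis cnj_dirichlet_sum complex_mod_cnj)

lemma norm_dirichlet_sum_mult_sin_le: "cmod (dirichlet_sum L x) * \<bar>sin (pi * x)\<bar> \<le> 1"
proof -
  have "dirichlet_sum L x * (e x - 1) = e (real L * x) - 1"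
    unfolding dirichlet_sum_def
    by (induction L) (simp_all add: algebra_simps e_add, simp add: e_def)
  then have "cmod (dirichlet_sum L x) * (2 * \<bar>sin (pi * x)\<bar>) = cmod (e (real L * x) - 1)"
    by (metis norm_mult norm_e_minus_1)
  also have "\<dots> \<le> 2" using norm_triangle_ineq4[of "e (real L * x)" 1] by simp
  finally show ?thesis by simp
qed

lemma two_min_frac_le_sin: "2 * min (frac x) (1 - frac x) \<le> \<bar>sin (pi * x)\<bar>"
proof -
  have fr: "0 \<le> frac x" "frac x < 1" by (simp_all add: frac_lt_1)
  have "x = frac x + of_int \<lfloor>x\<rfloor>" by (simp add: frac_def)
  then have "\<bar>sin (pi * x)\<bar> = \<bar>sin (pi * frac x + pi * of_int \<lfloor>x\<rfloor>)\<bar>"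
    by (metis distrib_left)
  also have "\<dots> = \<bar>sin (pi * frac x)\<bar>"
    by (simp add: sin_add abs_mult)
  finally have eq: "\<bar>sin (pi * x)\<bar> = \<bar>sin (pi * frac x)\<bar>" .
  show ?thesis
  proof (cases "frac x \<le> 1 / 2")
    case True
    then show ?thesis using two_x_le_sin_pi_x[of "frac x"] fr unfolding eq by auto
  next
    case False
    have "sin (pi * (1 - frac x)) = sin (pi * frac x)"
      by (simp add: algebra_simps sin_diff)
    then show ?thesis using two_x_le_sin_pi_x[of "1 - frac x"] fr False unfolding eq by auto
  qed
qed

text \<open>For i \<ge> 1 this is the decay 1/|sin|, weakened by i + 1 \<le> 2 i. The shift to i + 1
  lets the trivial bound L cover i = 0 in the same formula.\<close>

lemma norm_dirichlet_sum_bin_le: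
  assumes L: "L \<le> 2 * H" and i: "real i \<le> real H * frac x" "real i \<le> real H * (1 - frac x)"
  shows "cmod (dirichlet_sum L x) \<le> 2 * real H / (real i + 1)"
proof (cases "i = 0")
  case True
  then show ?thesis using norm_dirichlet_sum_le[of L x] L by simp
next
  case False
  have "cmod (dirichlet_sum L x) * (2 * min (frac x) (1 - frac x)) \<le> 1"
    using mult_left_mono[OF two_min_frac_le_sin norm_ge_zero] norm_dirichlet_sum_mult_sin_le
    by (rule order_trans)
  moreover have "real i \<le> real H * min (frac x) (1 - frac x)"
    using i by (auto simp: min_def)
  then have "cmod (dirichlet_sum L x) * (2 * real i)
      \<le> cmod (dirichlet_sum L x) * (2 * (real H * min (frac x) (1 - frac x)))"
    by (intro mult_left_mono) auto
  ultimately have "cmod (dirichlet_sum L x) * (2 * real i) \<le> real H"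
    using mult_left_mono[of _ 1 "real H"] by (fastforce simp: mult_ac)
  moreover have "cmod (dirichlet_sum L x) * (real i + 1) \<le> cmod (dirichlet_sum L x) * (2 * real i)"
    using False by (intro mult_left_mono) auto
  ultimately have "cmod (dirichlet_sum L x) * (real i + 1) \<le> 2 * real H" by linarith
  then show ?thesis by (simp add: field_simps)
qed

lemma sum_inverse_squares_le_2: "(\<Sum>i<n. 1 / (real i + 1)\<^sup>2) \<le> 2"
proof -
  \<comment> \<open>At n = 0 the convention 1 / 0 = 0 makes the claim 0 \<le> 2; from n = 1 on the
    bound telescopes.\<close>
  have "(\<Sum>i<n. 1 / (real i + 1)\<^sup>2) \<le> 2 - 1 / real n"
  proof (induction n)
    case (Suc n)
    have "1 / (real n + 1)\<^sup>2 \<le> 1 / real n - 1 / (real n + 1)" if "n > 0"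
      using that by (simp add: divide_simps power2_eq_square)
    then show ?case using Suc by (cases "n = 0") (auto simp: add.commute)
  qed simp
  also have "\<dots> \<le> 2" by simp
  finally show ?thesis .
qed

text \<open>The circle is cut into H arcs of length 1/H starting at \<beta>, each holding at most K
  points. A point in arc j is at distance at least min j (H - 1 - j) / H from \<beta>, so the series
  of inverse squares occurs once from each side.\<close>

lemma sum_norm_dirichlet_sum_le:
  fixes \<alpha> :: "'i \<Rightarrow> real"
  assumes I: "finite I" and H: "H > 0" and L: "L \<le> 2 * H"
    and K: "\<And>\<beta>. card {i \<in> I. frac (\<alpha> i - \<beta>) < 1 / real H} \<le> K"
  shows "(\<Sum>i\<in>I. (cmod (dirichlet_sum L (\<alpha> i - \<beta>)))\<^sup>2) \<le> 16 * (real H)\<^sup>2 * real K"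
proof -
  define b where "b i = nat \<lfloor>real H * frac (\<alpha> i - \<beta>)\<rfloor>" for i
  define w where "w i = (2 * real H / (real i + 1))\<^sup>2" for i :: nat
  have b: "real (b i) \<le> real H * frac (\<alpha> i - \<beta>)" "real H * frac (\<alpha> i - \<beta>) < real (b i) + 1" for i
    unfolding b_def by (simp_all add: H)
  have bH: "b i < H" for i
  proof -
    have "real H * frac (\<alpha> i - \<beta>) < real H * 1" using H frac_lt_1 by (intro mult_strict_left_mono) auto
    then show ?thesis using b(1)[of i] by linarith
  qed
  have le: "(cmod (dirichlet_sum L (\<alpha> i - \<beta>)))\<^sup>2 \<le> w (b i) + w (H - 1 - b i)" for i
  proof -
    define j where "j = min (b i) (H - 1 - b i)"
    have "real j \<le> real H * frac (\<alpha> i - \<beta>)" using b(1)[of i] by (simp add: j_def)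
    moreover have "real j \<le> real H - 1 - real (b i)" using bH[of i] unfolding j_def by linarith
    then have "real j \<le> real H * (1 - frac (\<alpha> i - \<beta>))" using b(2)[of i] by (simp add: algebra_simps)
    ultimately have "(cmod (dirichlet_sum L (\<alpha> i - \<beta>)))\<^sup>2 \<le> w j"
      unfolding w_def by (intro power_mono norm_dirichlet_sum_bin_le L) auto
    \<comment> \<open>The smaller index is traded for both, so that the sums from the two sides of
      \<beta> can be reindexed separately.\<close>
    moreover have "w j \<le> w (b i) + w (H - 1 - b i)"
      by (auto simp: j_def min_def w_def)
    ultimately show ?thesis by linarith
  qed
  have cardK: "card {i \<in> I. b i = j} \<le> K" for j
  proof -
    have "{i \<in> I. b i = j} \<subseteq> {i \<in> I. frac (\<alpha> i - (\<beta> + real j / real H)) < 1 / real H}"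
    proof safe
      fix i assume "j = b i"
      define y where "y = frac (\<alpha> i - \<beta>) - real (b i) / real H"
      have "real H * y = real H * frac (\<alpha> i - \<beta>) - real (b i)" using H by (simp add: y_def field_simps)
      then have "0 \<le> real H * y" "real H * y < 1" using b[of i] by linarith+
      then have y: "0 \<le> y" "y < 1 / real H" using H by (simp_all add: field_simps zero_le_mult_iff)
      have "1 / real H \<le> 1" using H by simp
      then have "frac y = y" using y by (simp add: frac_eq)
      moreover have "\<alpha> i - (\<beta> + real (b i) / real H) = y + of_int \<lfloor>\<alpha> i - \<beta>\<rfloor>"
        by (simp add: y_def frac_def)
      ultimately show "frac (\<alpha> i - (\<beta> + real (b i) / real H)) < 1 / real H"
        using y by (simp add: frac_def)
    qed
    then have "card {i \<in> I. b i = j} \<le> card {i \<in> I. frac (\<alpha> i - (\<beta> + real j / real H)) < 1 / real H}"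
      using I by (intro card_mono) auto
    also have "\<dots> \<le> K" by (rule K)
    finally show ?thesis .
  qed
  have "(\<Sum>i\<in>I. (cmod (dirichlet_sum L (\<alpha> i - \<beta>)))\<^sup>2) \<le> (\<Sum>i\<in>I. w (b i) + w (H - 1 - b i))"
    by (intro sum_mono le)
  also have "\<dots> = (\<Sum>j<H. \<Sum>i | i \<in> I \<and> b i = j. w (b i) + w (H - 1 - b i))"
    by (rule sum.group[symmetric]) (use I bH in auto)
  also have "\<dots> = (\<Sum>j<H. real (card {i \<in> I. b i = j}) * (w j + w (H - 1 - j)))"
    by (intro sum.cong) auto
  also have "\<dots> \<le> (\<Sum>j<H. real K * (w j + w (H - 1 - j)))"
    using cardK by (intro sum_mono mult_right_mono) (auto simp: w_def)
  also have "\<dots> = real K * ((\<Sum>j<H. w j) + (\<Sum>j<H. w (H - 1 - j)))"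
    by (simp add: sum_distrib_left sum.distrib distrib_left)
  also have "(\<Sum>j<H. w (H - 1 - j)) = (\<Sum>j<H. w j)"
    using sum.nat_diff_reindex[of w H] by simp
  also have "(\<Sum>j<H. w j) = 4 * (real H)\<^sup>2 * (\<Sum>j<H. 1 / (real j + 1)\<^sup>2)"
    by (simp add: w_def sum_distrib_left power_divide power_mult_distrib)
  also have "real K * (\<dots> + \<dots>) = (8 * (real H)\<^sup>2 * real K) * (\<Sum>j<H. 1 / (real j + 1)\<^sup>2)"
    by simp
  also have "\<dots> \<le> (8 * (real H)\<^sup>2 * real K) * 2"
    by (intro mult_left_mono sum_inverse_squares_le_2) auto
  finally show ?thesis by simp
qed

text \<open>|D_L(x)|^2 is the sum of e((j - k) x) over j, k < L, so opening the squares gives a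
  quadratic form with Fejer kernel entries. On the left only squares occur, so a partial sum over
  (j, k) can be extended to the full square.\<close>

lemma sum_norm_square_trig_poly:
  fixes \<alpha> :: "'i \<Rightarrow> real" and c :: "'i \<Rightarrow> complex"
  shows "complex_of_real (\<Sum>j<L. \<Sum>k<L. (cmod (\<Sum>r\<in>I. c r * e ((real j - real k) * \<alpha> r)))\<^sup>2)
       = (\<Sum>r\<in>I. \<Sum>s\<in>I. c r * cnj (c s) * of_real ((cmod (dirichlet_sum L (\<alpha> r - \<alpha> s)))\<^sup>2))"
proof -
  have D: "of_real ((cmod (dirichlet_sum L x))\<^sup>2) = (\<Sum>j<L. \<Sum>k<L. e ((real j - real k) * x))" for x
    unfolding complex_norm_square cnj_dirichlet_sum unfolding dirichlet_sum_def sum_product e_add[symmetric]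
    by (simp add: algebra_simps)
  have "complex_of_real ((cmod (\<Sum>r\<in>I. c r * e ((real j - real k) * \<alpha> r)))\<^sup>2)
      = (\<Sum>r\<in>I. \<Sum>s\<in>I. c r * cnj (c s) * e ((real j - real k) * (\<alpha> r - \<alpha> s)))" for j k
    unfolding complex_norm_square cnj_sum sum_product
    by (intro sum.cong refl) (simp add: cnj_e algebra_simps flip: e_add)
  then have "complex_of_real (\<Sum>j<L. \<Sum>k<L. (cmod (\<Sum>r\<in>I. c r * e ((real j - real k) * \<alpha> r)))\<^sup>2)
    = (\<Sum>j<L. \<Sum>k<L. \<Sum>r\<in>I. \<Sum>s\<in>I. c r * cnj (c s) * e ((real j - real k) * (\<alpha> r - \<alpha> s)))"
    by simp
  also have "\<dots> = (\<Sum>j<L. \<Sum>r\<in>I. \<Sum>k<L. \<Sum>s\<in>I. c r * cnj (c s) * e ((real j - real k) * (\<alpha> r - \<alpha> s)))"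
    by (intro sum.cong refl sum.swap)
  also have "\<dots> = (\<Sum>r\<in>I. \<Sum>j<L. \<Sum>k<L. \<Sum>s\<in>I. c r * cnj (c s) * e ((real j - real k) * (\<alpha> r - \<alpha> s)))"
    by (rule sum.swap)
  also have "\<dots> = (\<Sum>r\<in>I. \<Sum>j<L. \<Sum>s\<in>I. \<Sum>k<L. c r * cnj (c s) * e ((real j - real k) * (\<alpha> r - \<alpha> s)))"
    by (intro sum.cong refl sum.swap)
  also have "\<dots> = (\<Sum>r\<in>I. \<Sum>s\<in>I. \<Sum>j<L. \<Sum>k<L. c r * cnj (c s) * e ((real j - real k) * (\<alpha> r - \<alpha> s)))"
    by (intro sum.cong refl sum.swap)
  finally show ?thesis by (simp only: D sum_distrib_left)
qed

text \<open>
  Each $n \in [1, N]$ has at least $N$ representations $n = j - k$ with $0 \le j, k < 2N$; this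
  introduces the Fejer kernel, which decays fast enough to be summed over the points.
\<close>

lemma dual_large_sieve:
  fixes \<alpha> :: "'i \<Rightarrow> real" and c :: "'i \<Rightarrow> complex"
  assumes I: "finite I" and H: "H > 0" and N: "N \<le> H"
    and K: "\<And>\<beta>. card {i \<in> I. frac (\<alpha> i - \<beta>) < 1 / real H} \<le> K"
  shows "real N * (\<Sum>n=1..N. (cmod (\<Sum>r\<in>I. c r * e (real n * \<alpha> r)))\<^sup>2)
           \<le> 16 * (real H)\<^sup>2 * real K * (\<Sum>r\<in>I. (cmod (c r))\<^sup>2)"
proof -
  define T where "T x = (cmod (\<Sum>r\<in>I. c r * e (x * \<alpha> r)))\<^sup>2" for x
  define D where "D r s = (cmod (dirichlet_sum (2 * N) (\<alpha> r - \<alpha> s)))\<^sup>2" for r s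
  have T0: "T x \<ge> 0" for x by (simp add: T_def)
  have D0: "D r s \<ge> 0" for r s by (simp add: D_def)
  have Dsym: "D r s = D s r" for r s
    using norm_dirichlet_sum_uminus[of "2 * N" "\<alpha> r - \<alpha> s"] by (simp add: D_def)
  have "real N * (\<Sum>n=1..N. T (real n)) = (\<Sum>k<N. \<Sum>n=1..N. T (real (n + k) - real k))"
    by simp
  also have "\<dots> = (\<Sum>k<N. \<Sum>j\<in>(\<lambda>n. n + k) ` {1..N}. T (real j - real k))"
    by (rule sum.cong[OF refl], subst sum.reindex) auto
  also have "\<dots> \<le> (\<Sum>k<N. \<Sum>j<2*N. T (real j - real k))"
    by (intro sum_mono sum_mono2) (auto simp: T0)
  also have "\<dots> \<le> (\<Sum>k<2*N. \<Sum>j<2*N. T (real j - real k))"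
    by (intro sum_mono2) (auto intro!: sum_nonneg simp: T0)
  also have "\<dots> = (\<Sum>j<2*N. \<Sum>k<2*N. T (real j - real k))"
    by (rule sum.swap)
  also have "\<dots> \<le> cmod (\<Sum>r\<in>I. \<Sum>s\<in>I. c r * cnj (c s) * of_real (D r s))"
    unfolding T_def D_def sum_norm_square_trig_poly[symmetric] norm_of_real by (rule abs_ge_self)
  also have "\<dots> \<le> (\<Sum>r\<in>I. \<Sum>s\<in>I. cmod (c r * cnj (c s) * of_real (D r s)))"
    by (rule order_trans[OF norm_sum]) (intro sum_mono norm_sum)
  also have "\<dots> = (\<Sum>r\<in>I. \<Sum>s\<in>I. (cmod (c r) * cmod (c s)) * D r s)"
    by (simp add: norm_mult D0)
  \<comment> \<open>Schur's test: by AM-GM and the symmetry of \<open>D\<close> the form is bounded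
    through its row sums.\<close>
  also have "\<dots> \<le> (\<Sum>r\<in>I. \<Sum>s\<in>I. ((cmod (c r))\<^sup>2 / 2 + (cmod (c s))\<^sup>2 / 2) * D r s)"
  proof (intro sum_mono mult_right_mono D0)
    fix r s
    show "cmod (c r) * cmod (c s) \<le> (cmod (c r))\<^sup>2 / 2 + (cmod (c s))\<^sup>2 / 2"
      using sum_squares_bound[of "cmod (c r)" "cmod (c s)"] by simp
  qed
  also have "\<dots> = (\<Sum>r\<in>I. \<Sum>s\<in>I. (cmod (c r))\<^sup>2 / 2 * D r s) + (\<Sum>r\<in>I. \<Sum>s\<in>I. (cmod (c s))\<^sup>2 / 2 * D r s)"
    by (simp add: distrib_right sum.distrib)
  also have "(\<Sum>r\<in>I. \<Sum>s\<in>I. (cmod (c s))\<^sup>2 / 2 * D r s) = (\<Sum>s\<in>I. \<Sum>r\<in>I. (cmod (c s))\<^sup>2 / 2 * D s r)"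
    by (subst sum.swap) (simp only: Dsym)
  also have "(\<Sum>r\<in>I. \<Sum>s\<in>I. (cmod (c r))\<^sup>2 / 2 * D r s) + \<dots> = (\<Sum>r\<in>I. (cmod (c r))\<^sup>2 * (\<Sum>s\<in>I. D s r))"
    by (simp add: sum_distrib_left flip: sum.distrib) (simp add: Dsym mult.commute)
  also have "\<dots> \<le> (\<Sum>r\<in>I. (cmod (c r))\<^sup>2 * (16 * (real H)\<^sup>2 * real K))"
    unfolding D_def using N by (intro sum_mono mult_left_mono sum_norm_dirichlet_sum_le I H K) auto
  also have "\<dots> = 16 * (real H)\<^sup>2 * real K * (\<Sum>r\<in>I. (cmod (c r))\<^sup>2)"
    by (simp only: sum_distrib_right[symmetric] mult.commute)
  finally show ?thesis by (simp add: T_def)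
qed

text \<open>Duality: with \<open>c\<close> the conjugate of \<open>F\<close>, the mean square
  \<open>T\<close> equals the sum of \<open>a n * V n\<close>. Cauchy-Schwarz and the dual
  inequality bound N T^2 by B Z T, and one factor T cancels.\<close>

lemma large_sieve:
  fixes \<alpha> :: "'i \<Rightarrow> real" and a :: "nat \<Rightarrow> complex"
  assumes I: "finite I" and H: "H > 0" and N: "N \<le> H"
    and K: "\<And>\<beta>. card {i \<in> I. frac (\<alpha> i - \<beta>) < 1 / real H} \<le> K"
  shows "real N * (\<Sum>r\<in>I. (cmod (\<Sum>n=1..N. a n * e (real n * \<alpha> r)))\<^sup>2)
           \<le> 16 * (real H)\<^sup>2 * real K * (\<Sum>n=1..N. (cmod (a n))\<^sup>2)"
proof -
  define F where "F r = (\<Sum>n=1..N. a n * e (real n * \<alpha> r))" for r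
  define c where "c r = cnj (F r)" for r
  define T where "T = (\<Sum>r\<in>I. (cmod (F r))\<^sup>2)"
  define V where "V n = (\<Sum>r\<in>I. c r * e (real n * \<alpha> r))" for n :: nat
  define Z where "Z = (\<Sum>n=1..N. (cmod (a n))\<^sup>2)"
  define B where "B = 16 * (real H)\<^sup>2 * real K"
  have T0: "T \<ge> 0" and Z0: "Z \<ge> 0" by (simp_all add: T_def Z_def sum_nonneg)
  have "complex_of_real T = (\<Sum>r\<in>I. c r * F r)"
    unfolding T_def c_def by (simp add: complex_norm_square mult.commute del: of_real_power)
  also have "\<dots> = (\<Sum>r\<in>I. \<Sum>n=1..N. a n * (c r * e (real n * \<alpha> r)))"
    by (simp add: F_def sum_distrib_left mult_ac)
  also have "\<dots> = (\<Sum>n=1..N. a n * V n)"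
    by (subst sum.swap) (simp add: V_def sum_distrib_left)
  finally have "T = cmod (\<Sum>n=1..N. a n * V n)" using T0 by (metis norm_of_real abs_of_nonneg)
  also have "\<dots> \<le> (\<Sum>n=1..N. cmod (a n) * cmod (V n))"
    by (rule order_trans[OF norm_sum]) (simp add: norm_mult)
  finally have "T\<^sup>2 \<le> (\<Sum>n=1..N. cmod (a n) * cmod (V n))\<^sup>2" using T0 by (intro power_mono)
  also have "\<dots> \<le> Z * (\<Sum>n=1..N. (cmod (V n))\<^sup>2)"
    unfolding Z_def by (rule Cauchy_Schwarz_ineq_sum)
  finally have "real N * T\<^sup>2 \<le> Z * (real N * (\<Sum>n=1..N. (cmod (V n))\<^sup>2))"
    using mult_left_mono[of "T\<^sup>2" _ "real N"] by (subst mult.left_commute) simp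
  also have "\<dots> \<le> Z * (B * T)"
    using dual_large_sieve[OF I H N K, of c] Z0
    unfolding V_def B_def T_def c_def by (intro mult_left_mono) auto
  finally have *: "(real N * T) * T \<le> (B * Z) * T" by (simp add: power2_eq_square mult_ac)
  have "real N * T \<le> B * Z"
  proof (cases "T = 0")
    case True
    then show ?thesis using Z0 by (simp add: B_def)
  next
    case False
    then show ?thesis using * T0 by (metis mult_right_le_imp_le order_le_less)
  qed
  then show ?thesis unfolding B_def T_def Z_def F_def .
qed

section \<open>Well-distributed sets of moduli\<close>

locale well_distributed =
  fixes Q N M C X :: real and S :: "nat set" and \<delta> :: "nat \<Rightarrow> nat \<Rightarrow> int \<Rightarrow> real"
  assumes Q: "Q \<ge> 1" and N: "N \<ge> 1" and M: "0 \<le> M" "M \<le> Q"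
    and S: "\<And>q. q \<in> S \<Longrightarrow> M < real q \<and> real q \<le> M + Q"
    and C: "0 \<le> C"
    and \<delta>_nonneg: "\<And>t k l. 1 \<le> t \<Longrightarrow> 1 \<le> k \<Longrightarrow> \<delta> t k l \<ge> 0"
    and \<delta>_cong: "\<And>t k l l'. 1 \<le> t \<Longrightarrow> 1 \<le> k \<Longrightarrow> [l = l'] (mod int k) \<Longrightarrow> \<delta> t k l = \<delta> t k l'"
    and max_count_le: "\<And>t k l u. 1 \<le> t \<Longrightarrow> real t \<le> sqrt N \<Longrightarrow> 1 \<le> k \<Longrightarrow> real k \<le> sqrt N / real t \<Longrightarrow>
           coprime (int k) l \<Longrightarrow> real k * Q / sqrt N \<le> u \<Longrightarrow> u \<le> Q / real t \<Longrightarrow>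
           real (max_count M Q S t u k l)
             \<le> C * (1 + (real (card (quot_set S t)) / real k) / (Q / real t) * u) * \<delta> t k l"
    and sum_\<delta>_le: "\<And>t k. 1 \<le> t \<Longrightarrow> real t \<le> sqrt N \<Longrightarrow> 1 \<le> k \<Longrightarrow> real k \<le> sqrt N / real t \<Longrightarrow>
           (\<Sum>l'\<in>{l'\<in>{1..int k}. coprime (int k) l'}. \<delta> t k l') \<le> real k"
    and \<delta>_le: "\<And>t k l. 1 \<le> t \<Longrightarrow> real t \<le> sqrt N \<Longrightarrow> 1 \<le> k \<Longrightarrow> real k \<le> sqrt N / real t \<Longrightarrow>
           coprime (int k) l \<Longrightarrow> \<delta> t k l \<le> X"
begin

lemma sqrtN: "sqrt N \<ge> 1" "sqrt N > 0" "sqrt N * sqrt N = N"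
  using N by auto

lemma finite_S: "finite S"
proof (rule finite_subset)
  show "S \<subseteq> {..nat \<lfloor>M + Q\<rfloor>}" using S by (auto simp: le_nat_floor)
qed simp

lemma X_nonneg: "X \<ge> 0"
  using \<delta>_le[of 1 1 0] \<delta>_nonneg[of 1 1 0] sqrtN by simp

section \<open>Windows in the quotient sets\<close>

lemma finite_quot_set: "t \<ge> 1 \<Longrightarrow> finite (quot_set S t)"
  by (rule finite_imageD[of "\<lambda>q. t * q"])
     (auto intro!: finite_subset[OF _ finite_S] inj_onI simp: quot_set_def)

lemma quot_setD: "t \<ge> 1 \<Longrightarrow> q \<in> quot_set S t \<Longrightarrow> M / real t < real q \<and> real q \<le> (M + Q) / real t"
  using S[of "t * q"] by (simp add: quot_set_def field_simps)

text \<open>The maximum runs only over starting points in [M/t, (M + Q)/t]. As the quotient set lies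
  in that range, a starting point outside can be clamped to the nearer end without losing an
  element.\<close>

lemma card_window_le_max_count:
  assumes t: "t \<ge> 1"
  shows "card {q \<in> quot_set S t. y < real q \<and> real q \<le> y + u \<and> [int q = l] (mod int k)}
           \<le> max_count M Q S t u k l" (is "card (?A y) \<le> _")
proof -
  have fin: "finite (?A y)" for y using finite_quot_set[OF t] by simp
  have le: "card (?A y) \<le> max_count M Q S t u k l" if "y \<in> {M / real t..(M + Q) / real t}" for y
    unfolding max_count_def
  proof (rule Max_ge)
    show "finite ((\<lambda>y. card (?A y)) ` {M / real t .. (M + Q) / real t})"
      by (rule finite_subset[of _ "{..card (quot_set S t)}"])
         (auto intro!: card_mono finite_quot_set t)
  qed (use that in auto)
  define y' where "y' = min (max y (M / real t)) ((M + Q) / real t)"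
  have "M / real t \<le> (M + Q) / real t" using Q by (simp add: divide_right_mono)
  then have "y' \<in> {M / real t..(M + Q) / real t}" by (auto simp: y'_def)
  moreover have "?A y \<subseteq> ?A y'"
    using quot_setD[OF t] by (force simp: y'_def min_def max_def split: if_splits)
  ultimately show ?thesis using card_mono[OF fin, of "?A y" y'] le[of y'] by linarith
qed

text \<open>Four half-open windows of length u cover everything but the left endpoint w - 2 u of the
  closed one; the fifth, starting at w - 3 u, catches it.\<close>

lemma card_window_le_5_max_count:
  assumes t: "t \<ge> 1" and u: "u > 0"
  shows "card {q \<in> quot_set S t. \<bar>real q - w\<bar> \<le> 2 * u \<and> [int q = l] (mod int k)}
           \<le> 5 * max_count M Q S t u k l"
proof -
  define A where "A i = {q \<in> quot_set S t. w - 3 * u + real i * u < real q \<and>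
      real q \<le> w - 3 * u + real i * u + u \<and> [int q = l] (mod int k)}" for i :: nat
  have "{q \<in> quot_set S t. \<bar>real q - w\<bar> \<le> 2 * u \<and> [int q = l] (mod int k)} \<subseteq> (\<Union>i<5. A i)"
  proof
    fix q assume q: "q \<in> {q \<in> quot_set S t. \<bar>real q - w\<bar> \<le> 2 * u \<and> [int q = l] (mod int k)}"
    define v where "v = (real q - w) / u + 3"
    have v: "v \<ge> 1" "v \<le> 5" using q u by (auto simp: v_def field_simps abs_le_iff)
    define i where "i = nat (\<lceil>v\<rceil> - 1)"
    have i: "real i < v" "v \<le> real i + 1" using v unfolding i_def by linarith+
    have "real q = w - 3 * u + v * u" using u by (simp add: v_def field_simps)
    moreover have "real i * u < v * u" "v * u \<le> real i * u + u"
      using mult_strict_right_mono[OF i(1) u] mult_right_mono[OF i(2), of u] u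
      by (simp_all add: distrib_right)
    ultimately have "q \<in> A i" using q unfolding A_def by auto
    moreover have "i < 5" using i v by linarith
    ultimately show "q \<in> (\<Union>i<5. A i)" by blast
  qed
  moreover have "finite (\<Union>i<5. A i)" using finite_quot_set[OF t] by (auto simp: A_def)
  ultimately have "card {q \<in> quot_set S t. \<bar>real q - w\<bar> \<le> 2 * u \<and> [int q = l] (mod int k)}
      \<le> card (\<Union>i<5. A i)" by (intro card_mono)
  also have "\<dots> \<le> (\<Sum>i<5. card (A i))" by (rule card_UN_le) simp
  also have "\<dots> \<le> (\<Sum>i<(5::nat). max_count M Q S t u k l)"
    unfolding A_def by (intro sum_mono card_window_le_max_count t)
  finally show ?thesis by simp
qed

text \<open>
  Pigeonhole: cutting $(M, M + Q]$ into intervals of length $Q/\sqrt N$ shows that (i) cannot hold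
  with a small $C$. Hence the single fraction $b/r$ itself is covered by the term $C N U$.
\<close>

lemma C_ge_third:
  assumes "S \<noteq> {}"
  shows "C \<ge> 1 / 3"
proof -
  define u where "u = Q / sqrt N"
  define A where "A = max_count M Q S 1 u 1 0"
  have u: "u > 0" using Q sqrtN by (simp add: u_def)
  have quot: "quot_set S 1 = S" using S M by (force simp: quot_set_def)
  define J where "J = nat \<lceil>sqrt N\<rceil>"
  have J: "sqrt N \<le> real J" "real J \<le> 2 * sqrt N" using sqrtN unfolding J_def by linarith+
  define B where "B i = {q \<in> quot_set S 1. M + real i * u < real q \<and> real q \<le> M + real i * u + u
                          \<and> [int q = 0] (mod int 1)}" for i :: nat
  have B: "card (B i) \<le> A" for i
    unfolding B_def A_def by (rule card_window_le_max_count) simp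
  have finB: "finite (B i)" for i unfolding B_def quot using finite_S by simp
  have SB: "S \<subseteq> (\<Union>i<J. B i)"
  proof
    fix q assume q: "q \<in> S"
    define v where "v = (real q - M) / u"
    have qv: "real q = M + v * u" using u by (simp add: v_def)
    have v0: "v > 0" using S[OF q] u by (simp add: v_def)
    have "v * u \<le> Q" using S[OF q] qv by linarith
    then have vJ: "v \<le> sqrt N" using Q sqrtN by (simp add: u_def field_simps)
    define i where "i = nat (\<lceil>v\<rceil> - 1)"
    have i: "real i < v" "v \<le> real i + 1" using v0 unfolding i_def by linarith+
    have "i < J" using i(1) vJ J(1) by linarith
    moreover have "real i * u < v * u" "v * u \<le> real i * u + u"
      using mult_strict_right_mono[OF i(1) u] mult_right_mono[OF i(2), of u] u
      by (simp_all add: distrib_right)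
    then have "q \<in> B i" using q qv unfolding B_def quot by auto
    ultimately show "q \<in> (\<Union>i<J. B i)" by blast
  qed
  have "card S \<le> card (\<Union>i<J. B i)" by (rule card_mono[OF _ SB]) (use finB in auto)
  also have "\<dots> \<le> (\<Sum>i<J. card (B i))" by (rule card_UN_le) simp
  also have "\<dots> \<le> (\<Sum>i<J. A)" by (intro sum_mono B)
  finally have cardS: "card S \<le> J * A" by simp
  then have "A > 0" using assms finite_S by (metis card_gt_0_iff gr0I mult_0_right not_le)
  have "real (card S) \<le> real J * real A" using cardS by (metis of_nat_le_iff of_nat_mult)
  also have "\<dots> \<le> 2 * sqrt N * real A" using J by (intro mult_right_mono) auto
  finally have cS: "real (card S) / sqrt N \<le> 2 * real A" using sqrtN by (simp add: field_simps)
  \<comment> \<open>For k = 1 the sum in (ii) has the single term l' = 1, and its bound is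
    1.\<close>
  have "\<delta> 1 1 0 = \<delta> 1 1 1" by (rule \<delta>_cong) auto
  moreover have "\<delta> 1 1 1 \<le> 1"
  proof -
    have "{l' \<in> {1..int 1}. coprime (int 1) l'} = {1}" by auto
    then show ?thesis using sum_\<delta>_le[of 1 1] sqrtN by simp
  qed
  ultimately have d: "\<delta> 1 1 0 \<le> 1" "\<delta> 1 1 0 \<ge> 0" using \<delta>_nonneg[of 1 1 0] by auto
  have "u \<le> Q" using Q sqrtN by (simp add: u_def field_simps)
  then have "real A \<le> C * (1 + real (card S) / Q * u) * \<delta> 1 1 0"
    using max_count_le[of 1 1 0 u] sqrtN Q unfolding A_def quot by (simp add: u_def)
  also have "\<dots> \<le> C * (1 + real (card S) / Q * u)"
    using d C Q u mult_left_mono[of "\<delta> 1 1 0" 1 "C * (1 + real (card S) / Q * u)"] by simp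
  also have "real (card S) / Q * u = real (card S) / sqrt N" using Q by (simp add: u_def)
  \<comment> \<open>A nonempty \<open>S\<close> gives A \<ge> 1, so 1 + 2 A \<le> 3 A; hence the
    constant 1/3.\<close>
  also have "C * (1 + \<dots>) \<le> C * (3 * real A)"
    using cS \<open>A > 0\<close> C by (intro mult_left_mono) auto
  finally have "1 * real A \<le> (3 * C) * real A" by simp
  then have "1 \<le> 3 * C" using \<open>A > 0\<close> by (subst (asm) mult_le_cancel_right) auto
  then show ?thesis by simp
qed

text \<open>Multiplication by a unit c permutes the reduced residues, so any k consecutive values of
  m reproduce the sum in (ii).\<close>

lemma sum_\<delta>_block_le:
  assumes t: "1 \<le> t" "real t \<le> sqrt N" and k: "1 \<le> k" "real k \<le> sqrt N / real t"
    and c: "coprime (int k) c"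
  shows "(\<Sum>m | m \<in> {s + 1..s + int k} \<and> coprime (int k) m. \<delta> t k (c * m)) \<le> real k"
proof -
  \<comment> \<open>Shifting by 1 before and after the reduction gives representatives in 1, ..., k,
    the range used in (ii), instead of 0, ..., k - 1.\<close>
  define g where "g m = (c * m - 1) mod int k + 1" for m
  let ?B = "{m. m \<in> {s + 1..s + int k} \<and> coprime (int k) m}"
  have g_cong: "[g m = c * m] (mod int k)" for m
    using mod_add_left_eq[of "c * m - 1" "int k" 1] by (simp add: g_def unique_euclidean_semiring_class.cong_def)
  have inj: "inj_on g ?B"
  proof (rule inj_onI)
    fix x y assume xy: "x \<in> ?B" "y \<in> ?B" "g x = g y"
    then have "[c * x = c * y] (mod int k)" by (metis cong_sym cong_trans g_cong)
    then have "[x = y] (mod int k)" using c by (simp add: cong_mult_lcancel coprime_commute)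
    then have "int k dvd x - y" by (simp add: cong_iff_dvd_diff)
    moreover have "\<bar>x - y\<bar> < int k" using xy by auto
    ultimately show "x = y" using zdvd_imp_le[of "int k" "\<bar>x - y\<bar>"] by fastforce
  qed
  have "(\<Sum>m\<in>?B. \<delta> t k (c * m)) = (\<Sum>m\<in>?B. \<delta> t k (g m))"
    by (intro sum.cong refl \<delta>_cong cong_sym[OF g_cong] t k)
  also have "\<dots> = (\<Sum>l\<in>g ` ?B. \<delta> t k l)"
    using inj by (simp add: sum.reindex)
  also have "\<dots> \<le> (\<Sum>l'\<in>{l'\<in>{1..int k}. coprime (int k) l'}. \<delta> t k l')"
  proof (rule sum_mono2)
    show "g ` ?B \<subseteq> {l'\<in>{1..int k}. coprime (int k) l'}"
    proof safe
      fix m assume "coprime (int k) m"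
      then have "coprime (int k) (c * m)" using c by simp
      then show "coprime (int k) (g m)"
        using g_cong[of m] by (metis cong_imp_coprime cong_sym coprime_commute)
      have "0 \<le> (c * m - 1) mod int k" "(c * m - 1) mod int k < int k" using k by auto
      then show "g m \<in> {1..int k}" by (auto simp: g_def)
    qed
    show "finite {l'\<in>{1..int k}. coprime (int k) l'}"
      by (rule finite_subset[of _ "{1..int k}"]) auto
  qed (use \<delta>_nonneg t k in auto)
  also have "\<dots> \<le> real k" by (rule sum_\<delta>_le[OF t k])
  finally show ?thesis .
qed

text \<open>For Y \<ge> k, rounding up to whole periods costs at most Y + k \<le> 2 Y by (ii). For Y
  < k only part of one period occurs; (ii) bounds it by k and (iii) by X Y.\<close>

lemma sum_\<delta>_le_min:
  assumes t: "1 \<le> t" "real t \<le> sqrt N" and k: "1 \<le> k" "real k \<le> sqrt N / real t"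
    and c: "coprime (int k) c" and Y: "Y \<ge> 0"
  shows "(\<Sum>m | m \<in> {1..\<lfloor>Y\<rfloor>} \<and> coprime (int k) m. \<delta> t k (c * m)) \<le> 2 * Y + min (real k) (X * Y)"
    (is "?s \<lfloor>Y\<rfloor> \<le> _")
proof -
  have fin: "finite {m. m \<in> {i..j::int} \<and> coprime (int k) m}" for i j
    by (rule finite_subset[of _ "{i..j}"]) auto
  have mono: "?s x \<le> ?s y" if "x \<le> y" for x y
    using that by (intro sum_mono2 fin) (auto intro: \<delta>_nonneg[OF t(1) k(1)])
  have blocks: "?s (int (j * k)) \<le> real (j * k)" for j
  proof (induction j)
    case (Suc j)
    have jk: "int (Suc j * k) = int (j * k) + int k" and jk0: "int (j * k) \<ge> 0"
      by (simp_all add: distrib_right del: of_nat_mult)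
    have "{m. m \<in> {1..int (Suc j * k)} \<and> coprime (int k) m}
        = {m. m \<in> {1..int (j * k)} \<and> coprime (int k) m}
        \<union> {m. m \<in> {int (j * k) + 1..int (j * k) + int k} \<and> coprime (int k) m}"
      unfolding jk using jk0 by (auto simp del: of_nat_mult)
    then have "?s (int (Suc j * k)) = ?s (int (j * k))
        + (\<Sum>m | m \<in> {int (j * k) + 1..int (j * k) + int k} \<and> coprime (int k) m. \<delta> t k (c * m))"
      by (simp only:) (rule sum.union_disjoint[OF fin fin], auto)
    also have "\<dots> \<le> real (j * k) + real k"
      by (intro add_mono Suc sum_\<delta>_block_le t k c)
    finally show ?case by (simp add: algebra_simps)
  qed simp
  show ?thesis
  proof (cases "Y < real k")
    case True
    have "?s \<lfloor>Y\<rfloor> \<le> ?s (int (1 * k))" using True by (intro mono) linarith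
    also have "\<dots> \<le> real (1 * k)" by (rule blocks)
    finally have 1: "?s \<lfloor>Y\<rfloor> \<le> real k" by simp
    have "?s \<lfloor>Y\<rfloor> \<le> (\<Sum>m | m \<in> {1..\<lfloor>Y\<rfloor>} \<and> coprime (int k) m. X)"
      using c by (intro sum_mono \<delta>_le t k) auto
    also have "\<dots> \<le> (\<Sum>m\<in>{1..\<lfloor>Y\<rfloor>}. X)"
      using X_nonneg by (intro sum_mono2) auto
    also have "\<dots> \<le> X * Y" using Y X_nonneg by (simp add: mult.commute mult_left_mono)
    finally show ?thesis using 1 Y by linarith
  next
    case False
    define n where "n = nat \<lfloor>Y\<rfloor>"
    have n: "\<lfloor>Y\<rfloor> = int n" "real n \<le> Y" using Y by (auto simp: n_def)
    have "n \<le> (n div k + 1) * k"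
      using k by (metis Suc_eq_plus1 dividend_less_times_div less_imp_le_nat mult.commute mult_Suc_right add.commute less_eq_Suc_le One_nat_def)
    then have "?s \<lfloor>Y\<rfloor> \<le> ?s (int ((n div k + 1) * k))" unfolding n by (intro mono) (simp only: of_nat_le_iff)
    also have "\<dots> \<le> real ((n div k + 1) * k)" by (rule blocks)
    also have "\<dots> = real (n div k * k) + real k" by (simp add: algebra_simps)
    also have "real (n div k * k) \<le> real n" by (simp only: of_nat_le_iff div_times_less_eq_dividend)
    finally have "?s \<lfloor>Y\<rfloor> \<le> 2 * Y" using False n by linarith
    moreover have "min (real k) (X * Y) \<ge> 0" using X_nonneg Y by simp
    ultimately show ?thesis by linarith
  qed
qed

text \<open>Negative m are handled by replacing c with -c, which is again coprime to k; this doubles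
  the bound.\<close>

lemma sum_\<delta>_symmetric_le:
  assumes t: "1 \<le> t" "real t \<le> sqrt N" and k: "1 \<le> k" "real k \<le> sqrt N / real t"
    and c: "coprime (int k) c" and Y: "Y \<ge> 0"
  shows "(\<Sum>m | m \<noteq> 0 \<and> \<bar>real_of_int m\<bar> \<le> Y \<and> coprime (int k) m. \<delta> t k (c * m))
           \<le> 4 * Y + 2 * min (real k) (X * Y)"
proof -
  let ?P = "{m. m \<in> {1..\<lfloor>Y\<rfloor>} \<and> coprime (int k) m}"
  have fin: "finite ?P" by (rule finite_subset[of _ "{1..\<lfloor>Y\<rfloor>}"]) auto
  have "{m. m \<noteq> 0 \<and> \<bar>real_of_int m\<bar> \<le> Y \<and> coprime (int k) m} \<subseteq> ?P \<union> uminus ` ?P"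
  proof
    fix m assume m: "m \<in> {m. m \<noteq> 0 \<and> \<bar>real_of_int m\<bar> \<le> Y \<and> coprime (int k) m}"
    show "m \<in> ?P \<union> uminus ` ?P"
    proof (cases "m > 0")
      case True
      then show ?thesis using m by (auto simp: le_floor_iff)
    next
      case False
      then have "- m \<in> ?P" using m by (auto simp: le_floor_iff)
      then show ?thesis by (intro UnI2 image_eqI[of _ _ "- m"]) auto
    qed
  qed
  then have "(\<Sum>m | m \<noteq> 0 \<and> \<bar>real_of_int m\<bar> \<le> Y \<and> coprime (int k) m. \<delta> t k (c * m))
      \<le> (\<Sum>m\<in>?P \<union> uminus ` ?P. \<delta> t k (c * m))"
    using fin by (intro sum_mono2) (auto intro: \<delta>_nonneg[OF t(1) k(1)])
  also have "\<dots> = (\<Sum>m\<in>?P. \<delta> t k (c * m)) + (\<Sum>m\<in>uminus ` ?P. \<delta> t k (c * m))"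
    using fin by (intro sum.union_disjoint) auto
  finally have "(\<Sum>m | m \<noteq> 0 \<and> \<bar>real_of_int m\<bar> \<le> Y \<and> coprime (int k) m. \<delta> t k (c * m))
      \<le> (\<Sum>m\<in>?P. \<delta> t k (c * m)) + (\<Sum>m\<in>uminus ` ?P. \<delta> t k (c * m))" .
  moreover have "(\<Sum>m\<in>uminus ` ?P. \<delta> t k (c * m)) = (\<Sum>m\<in>?P. \<delta> t k ((- c) * m))"
    by (subst sum.reindex) (auto intro: inj_onI)
  moreover have "(\<Sum>m\<in>?P. \<delta> t k ((- c) * m)) \<le> 2 * Y + min (real k) (X * Y)"
    by (rule sum_\<delta>_le_min[OF t k _ Y]) (use c in simp)
  moreover note sum_\<delta>_le_min[OF t k c Y]
  ultimately show ?thesis by linarith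
qed

end

section \<open>Fractions near a point\<close>

context well_distributed
begin

text \<open>Numerators range over all integers: the interval lies on the real line, which suits the
  Diophantine argument. The passage from the circle is made separately, in
  \<open>card_frac_near_le\<close>.\<close>

definition near_fractions :: "real \<Rightarrow> nat \<Rightarrow> (int \<times> nat) set" where
  "near_fractions \<alpha> H = {(a, q). q \<in> S \<and> coprime a (int q) \<and>
     \<alpha> \<le> real_of_int a / real q \<and> real_of_int a / real q < \<alpha> + 1 / real H}"

lemma S_pos: "q \<in> S \<Longrightarrow> q > 0"
  using S[of q] M by (auto intro: Nat.gr0I)

lemma finite_near_fractions: "finite (near_fractions \<alpha> H)"
proof (rule finite_subset)
  show "near_fractions \<alpha> H \<subseteq> (\<Union>q\<in>S. {\<lfloor>\<alpha> * real q\<rfloor>..\<lceil>(\<alpha> + 1 / real H) * real q\<rceil>} \<times> {q})"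
  proof safe
    fix a q assume "(a, q) \<in> near_fractions \<alpha> H"
    then have q: "q \<in> S" and "\<alpha> \<le> real_of_int a / real q" "real_of_int a / real q \<le> \<alpha> + 1 / real H"
      by (auto simp: near_fractions_def)
    then have "\<alpha> * real q \<le> real_of_int a" "real_of_int a \<le> (\<alpha> + 1 / real H) * real q"
      using S_pos[OF q] by (simp_all only: pos_le_divide_eq pos_divide_le_eq of_nat_0_less_iff)
    then have "a \<in> {\<lfloor>\<alpha> * real q\<rfloor>..\<lceil>(\<alpha> + 1 / real H) * real q\<rceil>}"
      by (simp del: of_int_mult) linarith
    then show "(a, q) \<in> (\<Union>q\<in>S. {\<lfloor>\<alpha> * real q\<rfloor>..\<lceil>(\<alpha> + 1 / real H) * real q\<rceil>} \<times> {q})"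
      using q by blast
  qed
qed (use finite_S in auto)

end

text \<open>The sign in b c = -1 makes q/t congruent to c m, because m is -b q/t modulo k. The
  alternative for \<zeta> ensures that z is divided by only when |z| \<ge> \<zeta>; the factor 2 in
  the bound for |z| comes from rounding sqrt N down in Dirichlet's theorem.\<close>

locale approximated_point = well_distributed +
  fixes r H :: nat and b c :: int and z \<zeta> :: real
  assumes r: "r \<ge> 1" "real r \<le> sqrt N" and b: "coprime b (int r)"
    and c: "[b * c = -1] (mod int r)"
    and \<zeta>: "1 / N \<le> \<zeta>" "\<zeta> \<le> 1 / (real r * sqrt N)" and z: "\<bar>z\<bar> \<le> 2 * \<zeta>" "\<zeta> \<le> \<bar>z\<bar> \<or> \<zeta> = 1 / N"
    and H: "N \<le> real H"
begin

section \<open>Offsets of the fractions near b/r + z\<close>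

definition near :: "(int \<times> nat) set" where
  "near = near_fractions (real_of_int b / real r + z) H"

lemma \<zeta>_pos: "\<zeta> > 0"
  using \<zeta>(1) N by (smt (verit) divide_pos_pos)

lemma N\<zeta>: "N * \<zeta> \<ge> 1" "N * \<zeta> * real r \<le> sqrt N"
proof -
  show "N * \<zeta> \<ge> 1" using \<zeta>(1) N by (simp add: field_simps)
  have "\<zeta> * (real r * sqrt N) \<le> 1" using \<zeta>(2) r sqrtN by (simp add: field_simps)
  then have "sqrt N * (\<zeta> * (real r * sqrt N)) \<le> sqrt N * 1" using sqrtN by (intro mult_left_mono) auto
  moreover have "sqrt N * (\<zeta> * (real r * sqrt N)) = (sqrt N * sqrt N) * \<zeta> * real r" by (simp only: mult_ac)
  ultimately show "N * \<zeta> * real r \<le> sqrt N" unfolding sqrtN(3) by simp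
qed

lemma near_cases:
  assumes "(a, q) \<in> near"
  shows "q \<in> S" "q > 0" "coprime a (int q)" "real q \<le> 2 * Q"
  using assms S_pos[of q] S[of q] M by (auto simp: near_def near_fractions_def)

text \<open>The fraction a/q differs from b/r + z by at most 1/N; the difference is multiplied by q
  r.\<close>

lemma offset_near:
  assumes "(a, q) \<in> near"
  shows "\<bar>real_of_int (a * int r - b * int q) - real q * real r * z\<bar> \<le> real q * real r / N"
proof -
  have q: "q > 0" using near_cases[OF assms] by simp
  define d where "d = real_of_int a / real q - real_of_int b / real r - z"
  have "0 \<le> d" "d \<le> 1 / real H" using assms by (auto simp: near_def near_fractions_def d_def)
  moreover have "1 / real H \<le> 1 / N" using H N by (intro divide_left_mono) auto
  ultimately have "\<bar>d\<bar> \<le> 1 / N" by simp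
  then have "\<bar>real q * real r * d\<bar> \<le> real q * real r * (1 / N)"
    by (simp only: abs_mult abs_of_nat mult_left_mono of_nat_0_le_iff mult_nonneg_nonneg)
  moreover have "real q * real r * d = real_of_int (a * int r - b * int q) - real q * real r * z"
    using q r by (simp add: d_def field_simps)
  ultimately show ?thesis by simp
qed

lemma offset_le:
  assumes "(a, q) \<in> near"
  shows "\<bar>real_of_int (a * int r - b * int q)\<bar> \<le> 6 * Q * real r * \<zeta>"
proof -
  have "\<bar>real_of_int (a * int r - b * int q)\<bar> \<le> \<bar>real q * real r * z\<bar> + real q * real r / N"
    using offset_near[OF assms] by linarith
  also have "\<dots> = real q * real r * (\<bar>z\<bar> + 1 / N)" by (simp add: abs_mult algebra_simps)
  \<comment> \<open>Here M \<le> Q enters through q \<le> 2 Q, and 3 \<zeta> is 2 \<zeta> for |z|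
    plus \<zeta> for 1/N.\<close>
  also have "\<dots> \<le> (2 * Q) * real r * (3 * \<zeta>)"
    using near_cases[OF assms] z \<zeta>(1) N by (intro mult_mono) auto
  finally show ?thesis by simp
qed

text \<open>For $\zeta = 1/N$ the offset $m$ carries no information on $q$, and the window is all of $(M, M + Q]$.\<close>

definition centre :: "int \<Rightarrow> real" where
  "centre m = (if \<zeta> = 1 / N then M + Q else real_of_int m / (real r * z))"

text \<open>When |z| \<ge> \<zeta>, the offset equals q r z up to q r / N, and dividing by r z
  recovers q up to q / (N |z|) \<le> 2 Q / (N \<zeta>).\<close>

lemma near_centre:
  assumes "(a, q) \<in> near"
  shows "\<bar>real q - centre (a * int r - b * int q)\<bar> \<le> 2 * (Q / (N * \<zeta>))"
proof (cases "\<zeta> = 1 / N")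
  case True
  have "\<bar>real q - (M + Q)\<bar> \<le> Q" using S[OF near_cases(1)[OF assms]] by linarith
  then show ?thesis unfolding centre_def using True Q N by simp
next
  case False
  then have z': "\<zeta> \<le> \<bar>z\<bar>" "\<bar>z\<bar> > 0" using z \<zeta>_pos by auto
  define m where "m = real_of_int (a * int r - b * int q)"
  have rz: "\<bar>real r * z\<bar> > 0" using z' r by (auto simp: abs_mult)
  have "real q - m / (real r * z) = - (m - real q * real r * z) / (real r * z)"
    using rz by (simp add: field_simps)
  then have "\<bar>real q - m / (real r * z)\<bar> = \<bar>m - real q * real r * z\<bar> / \<bar>real r * z\<bar>"
    by (simp only: abs_divide abs_minus_cancel)
  also have "\<dots> \<le> (real q * real r / N) / \<bar>real r * z\<bar>"
    using offset_near[OF assms] unfolding m_def by (intro divide_right_mono) auto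
  also have "\<dots> = real q / (N * \<bar>z\<bar>)" using r by (simp add: abs_mult field_simps)
  also have "\<dots> \<le> (2 * Q) / (N * \<zeta>)"
    using near_cases[OF assms] z' \<zeta>_pos N by (intro frac_le mult_left_mono) auto
  finally show ?thesis using False by (simp add: centre_def m_def)
qed

text \<open>Here \<open>m\<close> is the offset already divided by the gcd t, so that it is coprime
  to r/t.\<close>

definition fibre :: "nat \<Rightarrow> int \<Rightarrow> (int \<times> nat) set" where
  "fibre t m = {(a, q) \<in> near. gcd q r = t \<and> a * int (r div t) - b * int (q div t) = m}"

text \<open>Put q' = q/t and k = r/t. Both q' and b are coprime to k, so m, being -b q' modulo k, is
  a unit, and multiplication by c recovers q'.\<close>

lemma fibre_arith:
  assumes aq: "(a, q) \<in> fibre t m" and t: "t dvd r"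
  shows "q div t \<in> quot_set S t" "real (q div t) = real q / real t"
    "a * int r - b * int q = int t * m" "[int (q div t) = c * m] (mod int (r div t))"
    "coprime (int (r div t)) m"
proof -
  define k where "k = r div t"
  define q' where "q' = q div t"
  have in_near: "(a, q) \<in> near" and g: "gcd q r = t" and m: "m = a * int k - b * int q'"
    using aq by (auto simp: fibre_def k_def q'_def)
  have t0: "t > 0" using t r by (auto intro: Nat.gr0I)
  have rt: "r = t * k" using t by (simp add: k_def)
  have qt: "q = t * q'" using g by (auto simp: q'_def)
  have q'0: "q' > 0" using near_cases(2)[OF in_near] qt by (auto intro: Nat.gr0I)
  show "q div t \<in> quot_set S t" using q'0 t0 near_cases(1)[OF in_near] qt by (simp add: quot_set_def q'_def[symmetric])
  show "real (q div t) = real q / real t" using qt t0 by (simp add: q'_def[symmetric])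
  show "a * int r - b * int q = int t * m" unfolding m using rt qt by (simp add: algebra_simps)
  have "coprime q' k"
    using div_gcd_coprime[of q r] g r unfolding q'_def k_def by auto
  moreover have bk: "coprime b (int k)" using b rt by simp
  ultimately have cop: "coprime (b * int q') (int k)" by simp
  have mk: "[m = - (b * int q')] (mod int k)" unfolding m by (simp add: cong_iff_dvd_diff)
  then show "coprime (int (r div t)) m"
    using cop by (metis cong_imp_coprime cong_sym coprime_commute coprime_minus_left_iff k_def)
  have "[b * c = -1] (mod int k)" using c rt cong_dvd_modulus by (metis dvd_triv_right of_nat_mult)
  then have "[- (b * c) * int q' = 1 * int q'] (mod int k)"
    by (intro cong_mult cong_refl) (metis cong_minus_minus_iff minus_minus)
  moreover have "[c * m = c * - (b * int q')] (mod int k)" by (intro cong_mult cong_refl mk)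
  moreover have "c * - (b * int q') = - (b * c) * int q'" by simp
  ultimately have "[c * m = int q'] (mod int k)" by (metis cong_trans mult_1)
  then show "[int (q div t) = c * m] (mod int (r div t))"
    unfolding q'_def k_def by (rule cong_sym)
qed

text \<open>The quotient q/t determines the pair: it gives q, and then a r = t m + b q gives a. So
  the fibre embeds into one residue class inside one window.\<close>

lemma card_fibre_le:
  assumes t: "t dvd r"
  shows "card (fibre t m) \<le> 5 * max_count M Q S t (Q / (N * \<zeta>) / real t) (r div t) (c * m)"
proof -
  define u where "u = Q / (N * \<zeta>) / real t"
  have t0: "t \<ge> 1" using t r by (auto intro: Nat.gr0I simp: Suc_le_eq)
  have u: "u > 0" using Q N \<zeta>_pos t0 by (simp add: u_def)
  let ?V = "{q \<in> quot_set S t. \<bar>real q - centre (int t * m) / real t\<bar> \<le> 2 * u \<and>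
              [int q = c * m] (mod int (r div t))}"
  have "inj_on (\<lambda>(a, q). q div t) (fibre t m)"
  proof (rule inj_onI, clarify)
    fix a q a' q' assume A: "(a, q) \<in> fibre t m" "(a', q') \<in> fibre t m" "q div t = q' div t"
    have "gcd q r = t" "gcd q' r = t" using A by (auto simp: fibre_def)
    then have "t dvd q" "t dvd q'" by (metis gcd_dvd1)+
    then have "q = q'" using A(3) by (metis dvd_div_mult_self)
    moreover have "a * int r = a' * int r"
      using fibre_arith(3)[OF A(1) t] fibre_arith(3)[OF A(2) t] unfolding \<open>q = q'\<close> by linarith
    ultimately show "a = a' \<and> q = q'" using r by simp
  qed
  moreover have "(\<lambda>(a, q). q div t) ` fibre t m \<subseteq> ?V"
  proof clarify
    fix a q assume A: "(a, q) \<in> fibre t m"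
    then have in_near: "(a, q) \<in> near" by (simp add: fibre_def)
    have "\<bar>real q - centre (int t * m)\<bar> / real t \<le> 2 * (Q / (N * \<zeta>)) / real t"
      using near_centre[OF in_near] fibre_arith(3)[OF A t] by (intro divide_right_mono) auto
    moreover have "\<bar>real q - centre (int t * m)\<bar> / real t = \<bar>real (q div t) - centre (int t * m) / real t\<bar>"
      unfolding fibre_arith(2)[OF A t] by (simp add: diff_divide_distrib[symmetric] abs_divide)
    ultimately show "q div t \<in> quot_set S t \<and> \<bar>real (q div t) - centre (int t * m) / real t\<bar> \<le> 2 * u \<and>
        [int (q div t) = c * m] (mod int (r div t))"
      using fibre_arith(1,4)[OF A t] by (simp add: u_def)
  qed
  moreover have "finite ?V" using finite_quot_set[OF t0] by simp
  ultimately have "card (fibre t m) \<le> card ?V" by (rule card_inj_on_le)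
  also have "\<dots> \<le> 5 * max_count M Q S t u (r div t) (c * m)"
    by (rule card_window_le_5_max_count[OF t0 u])
  finally show ?thesis by (simp add: u_def)
qed

lemma coprime_c: "k dvd r \<Longrightarrow> coprime (int k) c"
proof -
  assume k: "k dvd r"
  then have "[c * b = -1] (mod int k)" using c cong_dvd_modulus[of "b * c" "-1" "int r" "int k"]
    by (simp add: mult.commute)
  then have "coprime (c * b) (int k)"
    by (metis cong_imp_coprime cong_sym coprime_minus_left_iff coprime_1_left)
  then show ?thesis by (simp add: coprime_commute)
qed

definition offsets :: "nat \<Rightarrow> int set" where
  "offsets t = {m. m \<noteq> 0 \<and> \<bar>real_of_int m\<bar> \<le> 6 * Q * real (r div t) * \<zeta> \<and> coprime (int (r div t)) m}"

lemma finite_offsets: "finite (offsets t)"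
  by (rule finite_subset[of _ "{- \<lfloor>6 * Q * real (r div t) * \<zeta>\<rfloor>..\<lfloor>6 * Q * real (r div t) * \<zeta>\<rfloor>}"])
     (auto simp: offsets_def le_floor_iff abs_le_iff, linarith+)

text \<open>Up to a constant, \<open>k * weight\<close> bounds the sum of \<delta> over the offsets:
  the first summand stands for whole periods, the second for an incomplete one.\<close>

definition weight :: real where
  "weight = Q * \<zeta> + min 1 (X * (Q * \<zeta>))"

lemma sum_card_fibre_le:
  assumes t: "t dvd r"
  shows "(\<Sum>m\<in>offsets t. real (card (fibre t m)))
           \<le> 120 * C * weight * (real r / real t + real (card (quot_set S t)) / (N * \<zeta>))"
proof -
  define k where "k = r div t"
  define u where "u = Q / (N * \<zeta>) / real t"
  have rt: "r = t * k" using t by (simp add: k_def)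
  have kr: "k dvd r" using rt by simp
  have t0: "t \<ge> 1" and k0: "k \<ge> 1" using r rt by (auto intro: Nat.gr0I simp: Suc_le_eq)
  have "t \<le> r" using t r by (simp add: dvd_imp_le)
  then have tN: "real t \<le> sqrt N" using r(2) by linarith
  have kN: "real k \<le> sqrt N / real t" using r(2) t0 rt by (simp add: field_simps)
  have Qt: "Q / real t > 0" using Q t0 by simp
  have "1 / (N * \<zeta>) \<le> 1" using N\<zeta> by simp
  then have "Q / real t * (1 / (N * \<zeta>)) \<le> Q / real t * 1" using Qt by (intro mult_left_mono) auto
  then have u2: "u \<le> Q / real t" by (simp add: u_def mult_ac)
  have u1: "real k * Q / sqrt N \<le> u"
  proof -
    have "Q * (N * \<zeta> * real r) \<le> Q * sqrt N" using N\<zeta>(2) Q by (intro mult_left_mono) auto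
    then show ?thesis using rt t0 N \<zeta>_pos sqrtN by (simp add: u_def field_simps)
  qed
  define D where "D = 1 + real (card (quot_set S t)) / (real k * (N * \<zeta>))"
  have D: "(real (card (quot_set S t)) / real k) / (Q / real t) * u = D - 1"
    using Q t0 k0 N \<zeta>_pos by (simp add: D_def u_def field_simps)
  have D0: "D \<ge> 0" using N \<zeta>_pos by (simp add: D_def)
  have bound: "real (card (fibre t m)) \<le> 5 * C * D * \<delta> t k (c * m)" if m: "m \<in> offsets t" for m
  proof -
    have "real (card (fibre t m)) \<le> 5 * real (max_count M Q S t u k (c * m))"
      using card_fibre_le[OF t, of m] unfolding u_def k_def
      by (metis of_nat_le_iff of_nat_mult of_nat_numeral)
    moreover have "coprime (int k) (c * m)" using m coprime_c[OF kr] by (simp add: offsets_def k_def)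
    from max_count_le[OF t0 tN k0 kN this u1 u2]
    have "real (max_count M Q S t u k (c * m)) \<le> C * D * \<delta> t k (c * m)"
      unfolding D by simp
    ultimately show ?thesis by linarith
  qed
  define Y where "Y = 6 * (real k * (Q * \<zeta>))"
  have Y0: "Y \<ge> 0" using Q \<zeta>_pos by (simp add: Y_def)
  have offsets_eq: "offsets t = {m. m \<noteq> 0 \<and> \<bar>real_of_int m\<bar> \<le> Y \<and> coprime (int k) m}"
    by (simp add: offsets_def Y_def k_def mult_ac)
  have "(\<Sum>m\<in>offsets t. \<delta> t k (c * m)) \<le> 4 * Y + 2 * min (real k) (X * Y)"
    unfolding offsets_eq by (rule sum_\<delta>_symmetric_le[OF t0 tN k0 kN coprime_c[OF kr] Y0])
  also have "min (real k) (X * Y) \<le> 6 * (real k * min 1 (X * (Q * \<zeta>)))"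
    by (auto simp: min_def Y_def mult_ac)
  \<comment> \<open>The factor 24 is 4 times the 6 in \<open>Y\<close>; the 5 windows of each fibre
    turn it into 120.\<close>
  also have "4 * Y + 2 * \<dots> \<le> 24 * (real k * weight)"
    using X_nonneg Q \<zeta>_pos k0 by (simp add: Y_def weight_def algebra_simps)
  finally have sum\<delta>: "(\<Sum>m\<in>offsets t. \<delta> t k (c * m)) \<le> 24 * (real k * weight)" by simp
  have "(\<Sum>m\<in>offsets t. real (card (fibre t m))) \<le> (\<Sum>m\<in>offsets t. 5 * C * D * \<delta> t k (c * m))"
    by (intro sum_mono bound)
  also have "\<dots> = 5 * C * D * (\<Sum>m\<in>offsets t. \<delta> t k (c * m))" by (simp add: sum_distrib_left)
  also have "\<dots> \<le> 5 * C * D * (24 * (real k * weight))" using C D0 sum\<delta> by (intro mult_left_mono) auto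
  also have "\<dots> = 120 * C * weight * (real k * D)" by simp
  also have "real k * D = real r / real t + real (card (quot_set S t)) / (N * \<zeta>)"
    using k0 t0 rt N \<zeta>_pos by (simp add: D_def field_simps)
  finally show ?thesis .
qed

section \<open>The exact hit and the count of all near fractions\<close>

definition near_exact :: "(int \<times> nat) set" where
  "near_exact = {(a, q) \<in> near. a * int r = b * int q}"

text \<open>Both a/q and b/r are in lowest terms with positive denominators, so equal values force
  equal terms.\<close>

lemma near_exact_subset: "near_exact \<subseteq> {(b, r)}"
proof clarify
  fix a q assume "(a, q) \<in> near_exact"
  then have in_near: "(a, q) \<in> near" and eq: "a * int r = b * int q" by (auto simp: near_exact_def)
  have "int q dvd a * int r" using eq by simp
  then have "int q dvd int r" using near_cases(3)[OF in_near] by (simp add: coprime_dvd_mult_right_iff coprime_commute)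
  moreover have "int r dvd b * int q" using eq by (metis dvd_triv_right)
  then have "int r dvd int q" using b by (simp add: coprime_dvd_mult_right_iff coprime_commute)
  ultimately have "q = r" by (simp add: dvd_antisym)
  then show "a = b \<and> q = r" using eq r by simp
qed

lemma card_near_exact_le: "real (card near_exact) \<le> 3 * C * (if M < sqrt N then 1 else 0)"
proof (cases "near_exact = {}")
  case False
  then have "(b, r) \<in> near_exact" using near_exact_subset by auto
  then have "r \<in> S" using near_cases(1) by (auto simp: near_exact_def)
  then have "M < sqrt N" "C \<ge> 1 / 3" using S[of r] r C_ge_third by auto
  moreover have "card near_exact \<le> 1" using card_mono[OF _ near_exact_subset] by simp
  ultimately show ?thesis by simp
qed (use C in simp)

lemma near_subset: "near \<subseteq> near_exact \<union> (\<Union>t\<in>{t. t dvd r}. \<Union>m\<in>offsets t. fibre t m)"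
proof clarify
  fix a q assume in_near: "(a, q) \<in> near" and "(a, q) \<notin> (\<Union>t\<in>{t. t dvd r}. \<Union>m\<in>offsets t. fibre t m)"
  define t where "t = gcd q r"
  define m where "m = a * int (r div t) - b * int (q div t)"
  have t: "t dvd r" by (simp add: t_def)
  have in_fibre: "(a, q) \<in> fibre t m" using in_near by (simp add: fibre_def t_def m_def)
  have t0: "t > 0" using r by (auto simp: t_def)
  have rt: "real r = real t * real (r div t)" using t by (metis dvd_mult_div_cancel of_nat_mult)
  have "\<bar>real_of_int (int t * m)\<bar> \<le> 6 * Q * real r * \<zeta>"
    using offset_le[OF in_near] fibre_arith(3)[OF in_fibre t] by simp
  then have "real t * \<bar>real_of_int m\<bar> \<le> real t * (6 * Q * real (r div t) * \<zeta>)"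
    by (simp add: rt abs_mult mult_ac)
  then have "\<bar>real_of_int m\<bar> \<le> 6 * Q * real (r div t) * \<zeta>" using t0 by simp
  moreover have "m \<notin> offsets t" using in_fibre t \<open>(a, q) \<notin> _\<close> by blast
  ultimately have "m = 0" using fibre_arith(5)[OF in_fibre t] by (auto simp: offsets_def)
  then show "(a, q) \<in> near_exact" using fibre_arith(3)[OF in_fibre t] in_near by (simp add: near_exact_def)
qed

lemma card_near_le:
  "real (card near) \<le> 3 * C * (if M < sqrt N then 1 else 0)
     + 120 * C * weight * (real r * (\<Sum>t | t dvd r. 1 / real t)
                      + real (\<Sum>t | t dvd r. card (quot_set S t)) / (N * \<zeta>))"
proof -
  have fin: "finite {t. t dvd r}" using r by simp
  have fin_near: "finite near" unfolding near_def by (rule finite_near_fractions)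
  have fin_fibre: "finite (fibre t m)" and fin_exact: "finite near_exact" for t m
    by (rule finite_subset[OF _ fin_near], force simp: fibre_def near_exact_def)+
  have "card near \<le> card (near_exact \<union> (\<Union>t\<in>{t. t dvd r}. \<Union>m\<in>offsets t. fibre t m))"
    by (rule card_mono[OF _ near_subset]) (use fin fin_fibre fin_exact finite_offsets in auto)
  also have "\<dots> \<le> card near_exact + card (\<Union>t\<in>{t. t dvd r}. \<Union>m\<in>offsets t. fibre t m)" by (rule card_Un_le)
  also have "card (\<Union>t\<in>{t. t dvd r}. \<Union>m\<in>offsets t. fibre t m) \<le> (\<Sum>t | t dvd r. card (\<Union>m\<in>offsets t. fibre t m))"
    by (rule card_UN_le[OF fin])
  also have "\<dots> \<le> (\<Sum>t | t dvd r. \<Sum>m\<in>offsets t. card (fibre t m))"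
    by (intro sum_mono card_UN_le finite_offsets)
  finally have "real (card near) \<le> real (card near_exact + (\<Sum>t | t dvd r. \<Sum>m\<in>offsets t. card (fibre t m)))"
    by (simp only: of_nat_le_iff)
  also have "\<dots> = real (card near_exact) + (\<Sum>t | t dvd r. \<Sum>m\<in>offsets t. real (card (fibre t m)))" by simp
  also have "(\<Sum>t | t dvd r. \<Sum>m\<in>offsets t. real (card (fibre t m)))
      \<le> (\<Sum>t | t dvd r. 120 * C * weight * (real r * (1 / real t) + real (card (quot_set S t)) / (N * \<zeta>)))"
    by (intro sum_mono) (use sum_card_fibre_le in auto)
  also have "\<dots> = 120 * C * weight * (real r * (\<Sum>t | t dvd r. 1 / real t)
                      + real (\<Sum>t | t dvd r. card (quot_set S t)) / (N * \<zeta>))"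
    by (simp only: sum_distrib_left sum.distrib sum_divide_distrib of_nat_sum distrib_left)
  also note card_near_exact_le
  finally show ?thesis by simp
qed

text \<open>The first bound, for the factor of the divisor sum, rests on the upper truncation N
  \<zeta> r \<le> sqrt N and on r \<le> sqrt N. The second, for the factor of the sum of S_t, rests
  on the lower truncation 1/\<zeta> \<le> N.\<close>

lemma N_weight_le: "N * weight * real r \<le> (min (Q * X) N + Q) * sqrt N" "weight / \<zeta> \<le> min (Q * X) N + Q"
proof -
  have "N * real r * min 1 (X * (Q * \<zeta>)) \<le> min (Q * X) N * sqrt N"
  proof (cases "Q * X \<le> N")
    case True
    have "N * real r * min 1 (X * (Q * \<zeta>)) \<le> N * real r * (X * (Q * \<zeta>))"
      using N by (intro mult_left_mono) auto
    also have "\<dots> = (Q * X) * (N * \<zeta> * real r)" by simp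
    also have "\<dots> \<le> (Q * X) * sqrt N" using N\<zeta>(2) Q X_nonneg by (intro mult_left_mono) auto
    finally show ?thesis using True by (simp add: min_def)
  next
    case False
    have "N * real r * min 1 (X * (Q * \<zeta>)) \<le> N * real r * 1"
      using N by (intro mult_left_mono) auto
    also have "\<dots> \<le> N * sqrt N" using r N by simp
    finally show ?thesis using False by (simp add: min_def)
  qed
  moreover have "N * real r * (Q * \<zeta>) \<le> Q * sqrt N"
    using mult_left_mono[OF N\<zeta>(2), of Q] Q by (simp add: mult_ac)
  moreover have "N * weight * real r = N * real r * (Q * \<zeta>) + N * real r * min 1 (X * (Q * \<zeta>))"
    by (simp add: weight_def algebra_simps)
  moreover have "(min (Q * X) N + Q) * sqrt N = Q * sqrt N + min (Q * X) N * sqrt N"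
    by (simp add: algebra_simps)
  ultimately show "N * weight * real r \<le> (min (Q * X) N + Q) * sqrt N" by linarith
  have "min 1 (X * (Q * \<zeta>)) \<le> min (Q * X) N * \<zeta>"
    using N\<zeta>(1) by (auto simp: min_def mult_ac)
  then show "weight / \<zeta> \<le> min (Q * X) N + Q" using \<zeta>_pos by (simp add: weight_def field_simps)
qed

lemma N_card_near_le:
  assumes f: "(\<Sum>t | t dvd r. 1 / real t) \<le> f" and f0: "f \<ge> 0"
    and g: "real (\<Sum>t | t dvd r. card (quot_set S t)) \<le> g"
  shows "N * real (card near) \<le> 120 * C * (N * (if M < sqrt N then 1 else 0)
           + (min (Q * X) N + Q) * (sqrt N * f + g))"
proof -
  define s where "s = (\<Sum>t | t dvd r. 1 / real t)"
  define G where "G = real (\<Sum>t | t dvd r. card (quot_set S t))"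
  define P where "P = min (Q * X) N + Q"
  define U where "U = (if M < sqrt N then 1 else 0 :: real)"
  have P0: "P \<ge> 0" using Q N X_nonneg by (simp add: P_def)
  have "N * real (card near) \<le> N * (3 * C * U + 120 * C * weight * (real r * s + G / (N * \<zeta>)))"
    using card_near_le N unfolding s_def G_def U_def by (intro mult_left_mono) auto
  also have "\<dots> = 3 * C * (N * U) + 120 * C * ((N * weight * real r) * s + (weight / \<zeta>) * G)"
    using N \<zeta>_pos by (simp add: field_simps)
  also have "\<dots> \<le> 120 * C * (N * U) + 120 * C * ((P * sqrt N) * f + P * g)"
  proof (intro add_mono mult_left_mono)
    show "3 * C * (N * U) \<le> 120 * C * (N * U)"
      using C N by (intro mult_right_mono) (auto simp: U_def)
    show "N * weight * real r * s \<le> P * sqrt N * f"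
      using N_weight_le(1) P0 N f sqrtN unfolding P_def s_def by (intro mult_mono[of _ _ "\<Sum>t | t dvd r. 1 / real t"]) (auto intro: sum_nonneg)
    show "weight / \<zeta> * G \<le> P * g"
      using N_weight_le(2) P0 g unfolding P_def G_def by (intro mult_mono of_nat_0_le_iff) auto
  qed (use C in auto)
  finally show ?thesis by (simp add: P_def U_def algebra_simps)
qed

end

section \<open>From a single point to the sieve bound\<close>

context well_distributed
begin

lemma N_card_near_fractions_le:
  assumes H: "N \<le> real H"
  shows "N * real (card (near_fractions \<alpha> H)) \<le> 2400 * C * (N * (if M < sqrt N then 1 else 0)
    + (min (Q * X) N + Q) * (sqrt N * ln (ln (10 * N))
       + real (Max ((\<lambda>r. \<Sum>t\<in>{t. t dvd r}. card (quot_set S t)) ` pos_upto (sqrt N)))))"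
proof -
  \<comment> \<open>Dirichlet's theorem needs an integer parameter; sqrt N \<ge> 1 ensures that
    rounding down loses at most a factor 2.\<close>
  define R where "R = nat \<lfloor>sqrt N\<rfloor>"
  have "R > 0" "real R > sqrt N - 1" "real R \<le> sqrt N"
    using sqrtN unfolding R_def by linarith+
  then have R: "R > 0" "real R \<le> sqrt N" "sqrt N \<le> 2 * real R" by linarith+
  obtain b k where bk: "coprime b k" "0 < k" "k \<le> int R"
      and approx: "\<bar>of_int k * \<alpha> - of_int b\<bar> < 1 / real R"
    using Dirichlet_approx_coprime[OF R(1)] by blast
  define r where "r = nat k"
  have k: "k = int r" and r: "r \<ge> 1" "real r \<le> sqrt N"
    using bk R unfolding r_def by linarith+
  obtain x where x: "[b * x = 1] (mod int r)"
    using cong_solve_coprime_int bk(1) unfolding k by blast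
  define z where "z = \<alpha> - real_of_int b / real r"
  \<comment> \<open>The two truncation levels are in the right order because r \<le> sqrt N.\<close>
  define \<zeta> where "\<zeta> = min (max \<bar>z\<bar> (1 / N)) (1 / (real r * sqrt N))"
  have "real r * \<bar>z\<bar> = \<bar>of_int k * \<alpha> - of_int b\<bar>"
    using r by (simp add: z_def k field_simps flip: abs_mult[of "real r", simplified])
  also have "\<dots> \<le> 2 / sqrt N"
  proof -
    have "real R > 0" using R(1) by simp
    then have "1 / real R \<le> 2 / sqrt N" using divide_left_mono[OF R(3), of 2] sqrtN(2) by simp
    then show ?thesis using approx by linarith
  qed
  finally have zle: "\<bar>z\<bar> \<le> 2 * (1 / (real r * sqrt N))"
    using r sqrtN by (simp add: field_simps)
  have "real r * sqrt N \<le> N" using mult_right_mono[OF r(2), of "sqrt N"] sqrtN by simp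
  then have le: "1 / N \<le> 1 / (real r * sqrt N)" using r sqrtN N by (intro divide_left_mono) auto
  interpret approximated_point Q N M C X S \<delta> r H b "- x" z \<zeta>
  proof unfold_locales
    show "coprime b (int r)" using bk k by simp
    show "[b * - x = - 1] (mod int r)" using x by (simp add: cong_minus_minus_iff)
    show "1 / N \<le> \<zeta>" "\<zeta> \<le> 1 / (real r * sqrt N)" "\<bar>z\<bar> \<le> 2 * \<zeta>" "\<zeta> \<le> \<bar>z\<bar> \<or> \<zeta> = 1 / N"
      using le zle N by (auto simp: \<zeta>_def min_def max_def)
  qed (use r H in auto)
  define g where "g = real (Max ((\<lambda>r. \<Sum>t\<in>{t. t dvd r}. card (quot_set S t)) ` pos_upto (sqrt N)))"
  define P where "P = min (Q * X) N + Q"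
  define U where "U = (if M < sqrt N then 1 else 0 :: real)"
  define f where "f = ln (ln (10 * N))"
  have fin: "finite (pos_upto (sqrt N))"
    by (rule finite_subset[of _ "{..nat \<lfloor>sqrt N\<rfloor>}"]) (auto simp: pos_upto_def le_nat_floor)
  have "(\<Sum>t\<in>{t. t dvd r}. card (quot_set S t))
      \<le> Max ((\<lambda>r. \<Sum>t\<in>{t. t dvd r}. card (quot_set S t)) ` pos_upto (sqrt N))"
    using r fin by (intro Max_ge) (auto simp: pos_upto_def)
  then have g: "real (\<Sum>t | t dvd r. card (quot_set S t)) \<le> g"
    unfolding g_def by (simp only: of_nat_le_iff)
  have f0: "20 * f \<ge> 0" using half_le_ln_ln(2)[OF N] by (simp add: f_def)
  have "(\<Sum>t | t dvd r. 1 / real t) \<le> 20 * f"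
    unfolding f_def using r by (intro sum_divisors_inverse_le_ln_ln N) auto
  from N_card_near_le[OF this f0 g]
  have "N * real (card near) \<le> 120 * C * (N * U + P * (sqrt N * (20 * f) + g))"
    by (simp only: U_def P_def)
  also have "\<dots> \<le> 120 * C * (20 * (N * U + P * (sqrt N * f + g)))"
  proof (intro mult_left_mono)
    have "P * g \<ge> 0" "N * U \<ge> 0" using Q N X_nonneg by (simp_all add: P_def g_def U_def)
    then show "N * U + P * (sqrt N * (20 * f) + g) \<le> 20 * (N * U + P * (sqrt N * f + g))"
      by (simp add: algebra_simps)
  qed (use C in auto)
  finally have "N * real (card near) \<le> 2400 * C * (N * U + P * (sqrt N * f + g))"
    by (simp only: mult.assoc mult.left_commute[of _ 20])
  moreover have "near = near_fractions \<alpha> H" unfolding near_def by (simp add: z_def)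
  ultimately show ?thesis by (simp only: U_def P_def f_def g_def)
qed

text \<open>Subtracting a multiple of q from b moves b/q into the interval starting at \<beta> and
  keeps it reduced. No two pairs collide, since numerators in 1, ..., q that agree modulo q are
  equal.\<close>

lemma card_frac_near_le:
  assumes H: "H > 0"
  shows "card {i \<in> (SIGMA q:S. {b\<in>{1..q}. coprime b q}). frac (real (snd i) / real (fst i) - \<beta>) < 1 / real H}
           \<le> card (near_fractions \<beta> H)" (is "card ?A \<le> _")
proof (rule card_inj_on_le[OF _ _ finite_near_fractions])
  define \<phi> where "\<phi> = (\<lambda>(q :: nat, b :: nat). (int b - \<lfloor>real b / real q - \<beta>\<rfloor> * int q, q))"
  show "inj_on \<phi> ?A"
  proof (rule inj_onI, clarify)
    fix q b q' b'
    assume A: "q \<in> S" "b \<in> {1..q}" "b' \<in> {1..q'}" "\<phi> (q, b) = \<phi> (q', b')"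
    then have q: "q' = q" by (simp add: \<phi>_def)
    have "int b - int b' = (\<lfloor>real b / real q - \<beta>\<rfloor> - \<lfloor>real b' / real q - \<beta>\<rfloor>) * int q"
      using A by (simp add: \<phi>_def q algebra_simps)
    then have "int q dvd int b - int b'" by simp
    moreover have "\<bar>int b - int b'\<bar> < int q" using A q by auto
    ultimately have "b = b'" using zdvd_imp_le[of "int q" "\<bar>int b - int b'\<bar>"] by fastforce
    then show "q = q' \<and> b = b'" using q by simp
  qed
  show "\<phi> ` ?A \<subseteq> near_fractions \<beta> H"
  proof
    fix x assume "x \<in> \<phi> ` ?A"
    then obtain q b where x: "x = \<phi> (q, b)" and A: "q \<in> S" "coprime b q"
        and fr: "frac (real b / real q - \<beta>) < 1 / real H" by auto
    define n where "n = \<lfloor>real b / real q - \<beta>\<rfloor>"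
    have q: "q > 0" using S_pos A by simp
    have eq: "real_of_int (int b - n * int q) / real q = real b / real q - real_of_int n"
      using q by (simp add: field_simps)
    have "coprime (int b - n * int q) (int q)"
      by (rule cong_imp_coprime[of "int b"]) (use A(2) in \<open>simp_all add: cong_iff_dvd_diff\<close>)
    moreover have "0 \<le> real b / real q - \<beta> - real_of_int n" "real b / real q - \<beta> - real_of_int n < 1 / real H"
      using fr frac_ge_0[of "real b / real q - \<beta>"] by (simp_all add: n_def frac_def)
    then have "\<beta> \<le> real_of_int (int b - n * int q) / real q"
        "real_of_int (int b - n * int q) / real q < \<beta> + 1 / real H"
      unfolding eq by linarith+
    ultimately show "x \<in> near_fractions \<beta> H"
      using A(1) by (simp add: x near_fractions_def \<phi>_def n_def[symmetric] del: of_int_diff of_int_mult)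
  qed
qed

lemma sieve_bound:
  "(\<Sum>q\<in>S. \<Sum>b\<in>{b\<in>{1..q}. coprime b q}. (cmod (exp_sum a N (real b / real q)))\<^sup>2)
     \<le> 307200 * C * (N * (if M < sqrt N then 1 else 0)
          + (min (Q * X) N + Q) * (sqrt N * ln (ln (10 * N))
             + real (Max ((\<lambda>r. \<Sum>t\<in>{t. t dvd r}. card (quot_set S t)) ` pos_upto (sqrt N)))))
        * (\<Sum>n\<in>pos_upto N. (cmod (a n))\<^sup>2)" (is "?L \<le> _ * C * ?R * ?Z")
proof -
  define n where "n = nat \<lfloor>N\<rfloor>"
  \<comment> \<open>N is real: the sum has \<open>n\<close> terms, while the arcs have length 1/H
    with H \<ge> N. Rounding costs H \<le> 2 N, which enters squared, and N \<le> 2 n, so the 16 of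
    the large sieve becomes 128.\<close>
  define H where "H = nat \<lceil>N\<rceil>"
  define T where "T = 2400 * C * ?R"
  \<comment> \<open>The number of points in an arc is an integer, so rounding its bound down loses
    nothing.\<close>
  define K where "K = nat \<lfloor>T / N\<rfloor>"
  define I where "I = (SIGMA q:S. {b\<in>{1..q}. coprime b q})"
  have "n > 0" "real n > N - 1" using N unfolding n_def by linarith+
  then have n: "n > 0" "N \<le> 2 * real n" by linarith+
  have H: "H > 0" "N \<le> real H" "real H \<le> 2 * N" "n \<le> H" using N unfolding H_def n_def by linarith+
  have pos_upto: "pos_upto N = {1..n}" using N by (auto simp: pos_upto_def n_def le_nat_floor) linarith
  have finI: "finite I" unfolding I_def using finite_S by auto
  have NT: "N * real (card (near_fractions \<beta> H)) \<le> T" for \<beta>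
    unfolding T_def by (rule N_card_near_fractions_le[OF H(2)])
  then have card: "card (near_fractions \<beta> H) \<le> K" for \<beta>
    unfolding K_def using N by (intro le_nat_floor) (simp add: field_simps)
  have "T \<ge> 0" using order_trans[OF _ NT[of 0]] N by simp
  then have "real K \<le> T / N" unfolding K_def using N by (intro of_nat_floor) simp
  then have NK: "N * real K \<le> T" using N by (simp add: field_simps)
  have "real n * (\<Sum>i\<in>I. (cmod (\<Sum>j=1..n. a j * e (real j * (real (snd i) / real (fst i)))))\<^sup>2)
      \<le> 16 * (real H)\<^sup>2 * real K * (\<Sum>j=1..n. (cmod (a j))\<^sup>2)"
    using card_frac_near_le[OF H(1)] card
    by (intro large_sieve finI H) (auto simp: I_def intro: order_trans)
  also have "(\<Sum>i\<in>I. (cmod (\<Sum>j=1..n. a j * e (real j * (real (snd i) / real (fst i)))))\<^sup>2) = ?L"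
    unfolding I_def using finite_S
    by (subst sum.Sigma) (auto simp: exp_sum_def pos_upto intro!: sum.cong)
  finally have "real n * ?L \<le> 16 * (real H)\<^sup>2 * real K * ?Z" by (simp only: pos_upto)
  also have "\<dots> \<le> 16 * (2 * N)\<^sup>2 * real K * ?Z"
    using H by (intro mult_right_mono mult_left_mono power_mono) (auto intro: sum_nonneg)
  also have "\<dots> = 64 * N * (N * real K * ?Z)" by (simp add: power2_eq_square)
  also have "\<dots> \<le> 64 * N * (T * ?Z)"
    using NK N by (intro mult_left_mono mult_right_mono) (auto intro: sum_nonneg)
  finally have 1: "real n * ?L \<le> 64 * N * (T * ?Z)" .
  have "?L \<ge> 0" by (intro sum_nonneg) auto
  then have "N * ?L \<le> 2 * real n * ?L" using n by (intro mult_right_mono)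
  then have "N * ?L \<le> N * (128 * (T * ?Z))" using 1 by simp
  then have "?L \<le> 128 * (T * ?Z)" using N by (subst (asm) mult_le_cancel_left_pos) auto
  then show ?thesis by (simp add: T_def)
qed

end

theorem theorem2:
  "\<exists>c\<^sub>2::real. c\<^sub>2 > 0 \<and>
    (\<forall>(Q::real) (N::real) (a::nat \<Rightarrow> complex) (M::real) (S::nat set)
       (C::real) (X::real) (\<delta>::nat \<Rightarrow> nat \<Rightarrow> int \<Rightarrow> real).
      Q \<ge> 1 \<longrightarrow> N \<ge> 1 \<longrightarrow> 0 \<le> M \<longrightarrow> M \<le> Q \<longrightarrow>
      (\<forall>q\<in>S. M < real q \<and> real q \<le> M + Q) \<longrightarrow>
      0 \<le> C \<longrightarrow>
      (\<forall>t\<ge>1. \<forall>k\<ge>1. \<forall>l. \<delta> t k l \<ge> 0) \<longrightarrow>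
      (\<forall>t\<ge>1. \<forall>k\<ge>1. \<forall>l l'. [l = l'] (mod int k) \<longrightarrow> \<delta> t k l = \<delta> t k l') \<longrightarrow>
      (\<forall>(t::nat) (k::nat) (l::int) (u::real).
         1 \<le> t \<longrightarrow> real t \<le> sqrt N \<longrightarrow>
         1 \<le> k \<longrightarrow> real k \<le> sqrt N / real t \<longrightarrow>
         coprime (int k) l \<longrightarrow>
         real k * Q / sqrt N \<le> u \<longrightarrow> u \<le> Q / real t \<longrightarrow>
           real (max_count M Q S t u k l)
             \<le> C * (1 + (real (card (quot_set S t)) / real k) / (Q / real t) * u) * \<delta> t k l \<and>
           (\<Sum>l'\<in>{l'\<in>{1..int k}. coprime (int k) l'}. \<delta> t k l') \<le> real k \<and>
           \<delta> t k l \<le> X) \<longrightarrow>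
      (\<Sum>q\<in>S. \<Sum>b\<in>{b\<in>{1..q}. coprime b q}. (cmod (exp_sum a N (real b / real q)))\<^sup>2)
        \<le> c\<^sub>2 * C *
           (N * (if M < sqrt N then 1 else 0) +
            (min (Q * X) N + Q) *
            (sqrt N * ln (ln (10 * N)) +
             real (Max ((\<lambda>r. \<Sum>t\<in>{t. t dvd r}. card (quot_set S t)) ` pos_upto (sqrt N))))) *
           (\<Sum>n\<in>pos_upto N. (cmod (a n))\<^sup>2))"
proof (rule exI[of _ 307200], intro conjI allI impI, goal_cases)
  case (2 Q N a M S C X \<delta>)
  note hyp = 2(9)[rule_format]
  \<comment> \<open>All three conditions are assumed under one quantifier over u, so (ii) and (iii)
    can be extracted only if some u is admissible. The bound on k makes the range nonempty, and u =
    Q / t serves; for (ii), where l does not occur, l = 1 is taken.\<close>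
  have u: "real k * Q / sqrt N \<le> Q / real t" if "1 \<le> t" "real k \<le> sqrt N / real t" for t k :: nat
  proof -
    have "real k * real t \<le> sqrt N" "sqrt N > 0" using that 2(2) by (simp_all add: field_simps)
    then have "Q * (real k * real t) \<le> Q * sqrt N" using 2(1) by (intro mult_left_mono) auto
    then show ?thesis using that(1) \<open>sqrt N > 0\<close> by (simp add: field_simps)
  qed
  interpret well_distributed Q N M C X S \<delta>
  proof unfold_locales
    fix t k :: nat and l :: int and v :: real
    assume tk: "1 \<le> t" "real t \<le> sqrt N" "1 \<le> k" "real k \<le> sqrt N / real t"
    show "(\<Sum>l'\<in>{l'\<in>{1..int k}. coprime (int k) l'}. \<delta> t k l') \<le> real k"
      using hyp[OF tk, of 1 "Q / real t"] u[OF tk(1,4)] by simp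
    assume l: "coprime (int k) l"
    show "\<delta> t k l \<le> X"
      using hyp[OF tk l u[OF tk(1,4)]] by simp
    assume "real k * Q / sqrt N \<le> v" "v \<le> Q / real t"
    then show "real (max_count M Q S t v k l)
             \<le> C * (1 + (real (card (quot_set S t)) / real k) / (Q / real t) * v) * \<delta> t k l"
      using hyp[OF tk l] by blast
  qed (use 2 in auto)
  show ?case by (rule sieve_bound)
qed simp

end
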